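(* Let $E=K(n,m,\mathcal D)$ be a Bedford-McMullen carpet of non-doubling type and assume that $a_0>a_{m-1}$. Let $\varphi$ be a gauge function satisfying $$\lim_{k\to\infty}\frac{k}{\varphi(n^{-k})}=s\in(0,+\infty].$$ Let $0<\rho<n^{-3}$, let $z\in E$ and let $\boldsymbol\omega\in\mathcal D^\infty$ be a coding of $z$. Then: (i) If $\boldsymbol\omega\notin\Omega_0\cup\Omega_{m-1}$, then $$\overline\delta_\varphi(z;\mu_E,\rho)=\limsup_{k\to\infty}\frac{\beta(k;\boldsymbol\omega)}{\varphi(n^{-k})}\cdot\log(a_0/a_{m-1}).$$ (ii) If $\boldsymbol\omega\in\Omega_0\cup\Omega_{m-1}$, then $\overline\delta_\varphi(z;\mu_E,\rho)=s(1/\sigma-1)\log(a_0/a_{m-1})\cdot\mathbf 1_{V_E}(z)$, where $\mathbf 1_{V_E}$ is the indicator function of $V_E$.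
   Context: Let $n>m\ge 2$ be integers, $\sigma=\log m/\log n$, and let $\mathcal D\subset\{0,\dots,n-1\}\times\{0,\dots,m-1\}$ be nonempty. For $\mathbf d\in\mathcal D$ let $S_{\mathbf d}(z)=\mathrm{diag}(n^{-1},m^{-1})(z+\mathbf d)$ on $\mathbb R^2$, and $S_{\mathbf d_1\dots\mathbf d_k}=S_{\mathbf d_1}\circ\cdots\circ S_{\mathbf d_k}$. The Bedford-McMullen carpet $E=K(n,m,\mathcal D)$ is the unique nonempty compact set with $E=\bigcup_{\mathbf d\in\mathcal D}S_{\mathbf d}(E)$, a metric space with the Euclidean distance. Its uniform Bernoulli measure $\mu_E$ is the unique Borel probability measure supported on $E$ with $\mu_E=\frac1{\#\mathcal D}\sum_{\mathbf d\in\mathcal D}\mu_E\circ S_{\mathbf d}^{-1}$. The fiber sequence is $a_j=\#\{i:(i,j)\in\mathcal D\}$, $0\le j\le m-1$. $B_r(x)$ denotes the open ball. A Borel probability measure $\mu$ is doubling if $\sup_{x\in\mathrm{supp}\,\mu,\ r>0}\mu(B_{2r}(x))/\mu(B_r(x))<\infty$. $E$ is of non-doubling type if $\mu_E$ is not doubling. (Known, due to Li-Wei-Wen: this holds if and only if $a_0a_{m-1}>0$, $a_0\ne a_{m-1}$, and $a_ja_{j+1}>0$ for some $0\le j\le m-2$.) A gauge function is a strictly decreasing $\varphi:(0,1)\to\mathbb R^+$ with $\lim_{r\to0}\varphi(r)=\infty$. For a measure $\mu$ on a metric space $X$ (here $X=E$), $0<\rho<1$ and $z\in X$, the upper doubling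 index is $$\overline\delta_\varphi(z;\mu,\rho)=\limsup_{r\to0}\ \sup_{z'\in X:\ B_{\rho r}(z')\subset B_r(z)}\frac{\log[\mu(B_r(z))/\mu(B_{\rho r}(z'))]}{\varphi(r)}.$$ A coding of $z\in E$ is a sequence $\boldsymbol\omega=(\mathbf d_j)_{j\ge1}\in\mathcal D^\infty$ with $\{z\}=\bigcap_{k\ge1}S_{\mathbf d_1\dots\mathbf d_k}([0,1]^2)$; writing $\mathbf d_j=(x_j,y_j)$, it is also written $(\mathbf x,\mathbf y)=((x_j)_j,(y_j)_j)$. $V_E$ is the set of $z\in E$ having two codings $(\mathbf x,\mathbf y)$, $(\mathbf x',\mathbf y')$ with $\mathbf y\ne\mathbf y'$. For $j\in\{0,\dots,m-1\}$, $\Omega_j$ is the set of $(\mathbf x,\mathbf y)\in\mathcal D^\infty$ such that $\mathbf y$ ends with $j^\infty$ (i.e. $y_i=j$ for all large $i$). Convention: $\infty\cdot0=0$. Reverse run length function $\beta$: let $\ell(k)=\lfloor k/\sigma\rfloor$, $\mathcal E=\{j:a_j>0\}$, $a\vee b=\max\{a,b\}$. For $p\in\{0,m-1\}$, $\boldsymbol\omega=(\mathbf x,\mathbf y)\in\mathcal D^\infty$ and $k\ge1$, let $h_p(k;\boldsymbol\omega)$ be the maximal integer $h$ with $1\le h\le\ell(k)$ and $y_h\ne p$ (and $h_p(k;\boldsymbol\omega)=0$ if there is none). Put $\beta_0(k;\boldsymbol\omega)=\ell(k)-(k\vee h_0(k;\boldsymbol\omega))$ if $h_0(k;\boldsymbol\omega)\ge1$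 and $y_{h_0(k;\boldsymbol\omega)}\in\mathcal E+1=\{j+1:j\in\mathcal E\}$, and $\beta_0(k;\boldsymbol\omega)=0$ otherwise. Put $\beta_{m-1}(k;\boldsymbol\omega)=\ell(k)-(k\vee h_{m-1}(k;\boldsymbol\omega))$ if $h_{m-1}(k;\boldsymbol\omega)\ge1$ and $y_{h_{m-1}(k;\boldsymbol\omega)}\in\mathcal E-1=\{j-1:j\in\mathcal E\}$, and $\beta_{m-1}(k;\boldsymbol\omega)=0$ otherwise. Finally $\beta(k;\boldsymbol\omega)=\beta_0(k;\boldsymbol\omega)\vee\beta_{m-1}(k;\boldsymbol\omega)$. *)

theory Defs
  imports "HOL-Probability.Probability"
begin

section \<open>Bedford-McMullen carpets\<close>

definition bm_map :: "nat \<Rightarrow> nat \<Rightarrow> nat \<times> nat \<Rightarrow> real \<times> real \<Rightarrow> real \<times> real" where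
  "bm_map n m d z = ((fst z + real (fst d)) / real n, (snd z + real (snd d)) / real m)"

definition is_carpet :: "nat \<Rightarrow> nat \<Rightarrow> (nat \<times> nat) set \<Rightarrow> (real \<times> real) set \<Rightarrow> bool" where
  "is_carpet n m D E \<longleftrightarrow> compact E \<and> E \<noteq> {} \<and> E = (\<Union>d\<in>D. bm_map n m d ` E)"

definition is_uniform_bernoulli ::
  "nat \<Rightarrow> nat \<Rightarrow> (nat \<times> nat) set \<Rightarrow> (real \<times> real) set \<Rightarrow> (real \<times> real) measure \<Rightarrow> bool" where
  "is_uniform_bernoulli n m D E \<mu> \<longleftrightarrow>
     prob_space \<mu> \<and> sets \<mu> = sets borel \<and> emeasure \<mu> (- E) = 0 \<and>
     (\<forall>A\<in>sets borel. measure \<mu> A = (\<Sum>d\<in>D. measure \<mu> (bm_map n m d -` A)) / real (card D))"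

definition fiber_count :: "(nat \<times> nat) set \<Rightarrow> nat \<Rightarrow> nat" where
  "fiber_count D j = card {i. (i, j) \<in> D}"

section \<open>Doubling measures and the upper doubling index\<close>

definition msupport :: "'a::metric_space measure \<Rightarrow> 'a set" where
  "msupport \<mu> = {x. \<forall>r>0. emeasure \<mu> (ball x r) > 0}"

text \<open>Only meant for Borel probability measures.\<close>

definition doubling :: "'a::metric_space measure \<Rightarrow> bool" where
  "doubling \<mu> \<longleftrightarrow>
     bdd_above {measure \<mu> (ball x (2 * r)) / measure \<mu> (ball x r) | x r. x \<in> msupport \<mu> \<and> r > 0}"

definition gauge_function :: "(real \<Rightarrow> real) \<Rightarrow> bool" where
  "gauge_function \<phi> \<longleftrightarrow>
     (\<forall>x\<in>{0<..<1}. \<forall>y\<in>{0<..<1}. x < y \<longrightarrow> \<phi> y < \<phi> x) \<and>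
     (\<forall>x\<in>{0<..<1}. \<phi> x > 0) \<and>
     filterlim \<phi> at_top (at_right 0)"

text \<open>The space \<open>X\<close> is a subset of the ambient type, and its open balls are the sets
  \<open>ball z r \<inter> X\<close>. The definition is only meant for measures charging all balls centred
  in \<open>X\<close>; otherwise the quotient below should be read as infinite where its denominator vanishes.\<close>

definition upper_doubling_index ::
  "'a::metric_space set \<Rightarrow> (real \<Rightarrow> real) \<Rightarrow> 'a measure \<Rightarrow> real \<Rightarrow> 'a \<Rightarrow> ereal" where
  "upper_doubling_index X \<phi> \<mu> \<rho> z =
     Limsup (at_right 0) (\<lambda>r.
       SUP z'\<in>{z'\<in>X. ball z' (\<rho> * r) \<inter> X \<subseteq> ball z r \<inter> X}.
         ereal (ln (measure \<mu> (ball z r \<inter> X) / measure \<mu> (ball z' (\<rho> * r) \<inter> X)) / \<phi> r))"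

section \<open>Codings\<close>

text \<open>A sequence \<open>(d\<^sub>j)\<^sub>j\<close> with \<open>j \<ge> 1\<close> is a function on the naturals whose value at
  \<open>0\<close> is irrelevant.\<close>

definition digit_seqs :: "(nat \<times> nat) set \<Rightarrow> (nat \<Rightarrow> nat \<times> nat) set" where
  "digit_seqs D = {1..} \<rightarrow> D"

primrec word_map :: "nat \<Rightarrow> nat \<Rightarrow> (nat \<Rightarrow> nat \<times> nat) \<Rightarrow> nat \<Rightarrow> real \<times> real \<Rightarrow> real \<times> real" where
  "word_map n m \<omega> 0 = id"
| "word_map n m \<omega> (Suc k) = word_map n m \<omega> k \<circ> bm_map n m (\<omega> (Suc k))"

definition is_coding ::
  "nat \<Rightarrow> nat \<Rightarrow> (nat \<times> nat) set \<Rightarrow> (nat \<Rightarrow> nat \<times> nat) \<Rightarrow> real \<times> real \<Rightarrow> bool" where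
  "is_coding n m D \<omega> z \<longleftrightarrow>
     \<omega> \<in> digit_seqs D \<and> {z} = (\<Inter>k\<in>{1..}. word_map n m \<omega> k ` ({0..1} \<times> {0..1}))"

definition V_set :: "nat \<Rightarrow> nat \<Rightarrow> (nat \<times> nat) set \<Rightarrow> (real \<times> real) set \<Rightarrow> (real \<times> real) set" where
  "V_set n m D E = {z \<in> E. \<exists>\<omega> \<omega>'. is_coding n m D \<omega> z \<and> is_coding n m D \<omega>' z \<and>
                                  (\<exists>j\<ge>1. snd (\<omega> j) \<noteq> snd (\<omega>' j))}"

definition Omega_set :: "(nat \<times> nat) set \<Rightarrow> nat \<Rightarrow> (nat \<Rightarrow> nat \<times> nat) set" where
  "Omega_set D j = {\<omega> \<in> digit_seqs D. \<forall>\<^sub>F i in sequentially. snd (\<omega> i) = j}"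

section \<open>The reverse run length function\<close>

definition bm_sigma :: "nat \<Rightarrow> nat \<Rightarrow> real" where
  "bm_sigma n m = ln (real m) / ln (real n)"

definition ell :: "nat \<Rightarrow> nat \<Rightarrow> nat \<Rightarrow> nat" where
  "ell n m k = nat \<lfloor>real k / bm_sigma n m\<rfloor>"

definition last_non :: "nat \<Rightarrow> nat \<Rightarrow> nat \<Rightarrow> nat \<Rightarrow> (nat \<Rightarrow> nat \<times> nat) \<Rightarrow> nat" where
  "last_non n m p k \<omega> =
     (let H = {h. 1 \<le> h \<and> h \<le> ell n m k \<and> snd (\<omega> h) \<noteq> p} in if H = {} then 0 else Max H)"

definition row_set :: "(nat \<times> nat) set \<Rightarrow> nat set" where
  "row_set D = {j. fiber_count D j > 0}"

text \<open>For \<open>n > m \<ge> 2\<close> we have \<open>k \<le> ell n m k\<close>, so the subtractions of naturals below do not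
  truncate. Membership of \<open>j\<close> in the row set shifted by \<open>-1\<close> is written as \<open>j + 1 \<in> row_set D\<close>,
  which avoids the truncated predecessor of \<open>0\<close>.\<close>

definition beta_bot ::
  "nat \<Rightarrow> nat \<Rightarrow> (nat \<times> nat) set \<Rightarrow> nat \<Rightarrow> (nat \<Rightarrow> nat \<times> nat) \<Rightarrow> nat" where
  "beta_bot n m D k \<omega> =
     (let h = last_non n m 0 k \<omega> in
      if h \<ge> 1 \<and> snd (\<omega> h) \<in> (\<lambda>j. j + 1) ` row_set D then ell n m k - max k h else 0)"

definition beta_top ::
  "nat \<Rightarrow> nat \<Rightarrow> (nat \<times> nat) set \<Rightarrow> nat \<Rightarrow> (nat \<Rightarrow> nat \<times> nat) \<Rightarrow> nat" where
  "beta_top n m D k \<omega> =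
     (let h = last_non n m (m - 1) k \<omega> in
      if h \<ge> 1 \<and> snd (\<omega> h) + 1 \<in> row_set D then ell n m k - max k h else 0)"

definition beta ::
  "nat \<Rightarrow> nat \<Rightarrow> (nat \<times> nat) set \<Rightarrow> nat \<Rightarrow> (nat \<Rightarrow> nat \<times> nat) \<Rightarrow> nat" where
  "beta n m D k \<omega> = max (beta_bot n m D k \<omega>) (beta_top n m D k \<omega>)"

end

theory Submission
  imports Defs
begin

text \<open>
  At scale \<open>r \<approx> n powr (-k)\<close> every ball is comparable to a bounded number of cells of width
  \<open>n powr (-k)\<close> and height \<open>m powr (- ell k)\<close>, and the mass of a cell is proportional to the
  product of the fiber counts of its row digits \<open>k + 1, \<dots>, ell k\<close>. So the mass ratio of two balls
  is governed by comparing adjacent rows. Adding one to a row index is an addition with carry: it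
  turns a final block of digits \<open>m - 1\<close> into digits \<open>0\<close> and alters one more digit, so the
  logarithms of the masses differ by the block length times \<open>ln (a 0 / a (m - 1))\<close> up to a
  constant. The block length (counted beyond position \<open>k\<close>) is \<open>beta\<close>, which gives the upper bound;
  constants disappear after division by the gauge. For the lower bound one needs the adjacent
  row to come close to \<open>z\<close>. This holds if the block starts after position \<open>k\<close>; otherwise one passes
  to the scale where the block starts, which is a legitimate replacement because there the block is
  as long as possible and \<open>k / \<phi> (1 / n ^ k)\<close> converges. If the block never ends, no such scale
  is available, and the adjacent row comes close to \<open>z\<close> at all scales precisely if \<open>z\<close> has a coding in it.
\<close>

section \<open>Radix expansions\<close>

text \<open>Masses are estimated by counting words: a word of length \<open>l\<close> contributes 1
  to a set containing its piece of \<open>E\<close> and 0 to a set missing that piece. Hence cells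
  overlapping along grid lines require no argument about null sets. The gauge is only monotone, so
  \<open>\<phi> r\<close> can be exchanged for \<open>\<phi> (1 / n ^ k)\<close> in one direction
  only. Upper bounds take \<open>k\<close> with \<open>1 / n ^ (k + 1) < r \<le> 1 / n ^ k\<close>;
  lower bounds take \<open>r = n ^ 2 / n ^ k\<close>, which is at least \<open>1 / n ^ k\<close>.
  Each choice makes the exchange go the right way. The factor \<open>n ^ 2\<close> lets the ball
  around \<open>z\<close> swallow a cell of the neighbouring row. Then
  \<open>\<rho> < 1 / n ^ 3\<close> makes the radius of the small ball less than
  \<open>1 / n ^ (k + 1)\<close>, at most a third of the height of a row, so the ball can be placed
  off the heavy row.\<close>

primrec radix :: "nat \<Rightarrow> (nat \<Rightarrow> nat) \<Rightarrow> nat \<Rightarrow> nat" where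
  "radix b f 0 = 0"
| "radix b f (Suc k) = b * radix b f k + f (Suc k)"

lemma radix_cong:
  "(\<And>i. i \<in> {1..k} \<Longrightarrow> f i = g i) \<Longrightarrow> radix b f k = radix b g k"
  by (induction k) auto

lemma radix_inj:
  assumes "radix b f k = radix b g k" "\<And>i. i \<in> {1..k} \<Longrightarrow> f i < b" "\<And>i. i \<in> {1..k} \<Longrightarrow> g i < b"
    and "i \<in> {1..k}"
  shows "f i = g i"
  using assms
proof (induction k)
  case (Suc k)
  have lt: "f (Suc k) < b" "g (Suc k) < b" using Suc.prems by auto
  have eq: "b * radix b f k + f (Suc k) = b * radix b g k + g (Suc k)" using Suc.prems(1) by simp
  have "f (Suc k) = (b * radix b f k + f (Suc k)) mod b" using lt by simp
  also have "\<dots> = (b * radix b g k + g (Suc k)) mod b" using eq by simp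
  also have "\<dots> = g (Suc k)" using lt by simp
  finally have last: "f (Suc k) = g (Suc k)" .
  hence "radix b f k = radix b g k" using eq lt by simp
  hence "i \<in> {1..k} \<Longrightarrow> f i = g i" using Suc.IH Suc.prems(2,3) by simp
  moreover have "i = Suc k \<or> i \<in> {1..k}" using Suc.prems(4) by auto
  ultimately show ?case using last by blast
qed simp

text \<open>The last digits decide, modulo \<open>b\<close>: either the last digit of
  \<open>f\<close> can be raised without overflow and the change stops there, or it is
  \<open>b - 1\<close>, that of \<open>g\<close> is 0, and the prefixes again differ by one. The
  carry stops at \<open>h\<close>.\<close>

lemma radix_adjacent:
  assumes "radix b g k = radix b f k + 1" "\<And>i. i \<in> {1..k} \<Longrightarrow> f i < b" "\<And>i. i \<in> {1..k} \<Longrightarrow> g i < b"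
  obtains h where "h \<in> {1..k}" "\<And>i. i \<in> {1..<h} \<Longrightarrow> f i = g i" "g h = f h + 1"
    "\<And>i. i \<in> {h<..k} \<Longrightarrow> f i = b - 1 \<and> g i = 0"
  using assms
proof (induction k arbitrary: thesis)
  case (Suc k)
  have lt: "f (Suc k) < b" "g (Suc k) < b" using Suc.prems by auto
  have eq: "b * radix b g k + g (Suc k) = b * radix b f k + f (Suc k) + 1" using Suc.prems(2) by simp
  show ?case
  proof (cases "f (Suc k) + 1 < b")
    case True
    have "g (Suc k) = (b * radix b g k + g (Suc k)) mod b" using lt by simp
    also have "\<dots> = (b * radix b f k + (f (Suc k) + 1)) mod b" using eq by (simp add: add.assoc)
    also have "\<dots> = f (Suc k) + 1" using True by simp
    finally have last: "g (Suc k) = f (Suc k) + 1" .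
    hence "radix b f k = radix b g k" using eq lt by simp
    hence "f i = g i" if "i \<in> {1..<Suc k}" for i
      by (rule radix_inj) (use Suc.prems(3,4) that in auto)
    thus ?thesis using last by (intro Suc.prems(1)[of "Suc k"]) simp_all
  next
    case False
    hence f: "f (Suc k) = b - 1" using lt by simp
    have "b * radix b g k + g (Suc k) = b * (radix b f k + 1)" using eq f lt by simp
    moreover have "g (Suc k) = (b * radix b g k + g (Suc k)) mod b" using lt by simp
    ultimately have g: "g (Suc k) = 0" by simp
    hence "b * radix b g k = b * (radix b f k + 1)"
      using \<open>b * radix b g k + g (Suc k) = b * (radix b f k + 1)\<close> by simp
    hence "radix b g k = radix b f k + 1" using lt by (subst (asm) mult_left_cancel) auto
    then obtain h where h: "h \<in> {1..k}" "\<And>i. i \<in> {1..<h} \<Longrightarrow> f i = g i" "g h = f h + 1"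
      "\<And>i. i \<in> {h<..k} \<Longrightarrow> f i = b - 1 \<and> g i = 0"
      using Suc.IH[OF _ \<open>radix b g k = radix b f k + 1\<close>] Suc.prems(3,4)
      by (metis atLeastAtMost_iff le_Suc_eq)
    show ?thesis
    proof (rule Suc.prems(1)[of h])
      fix i assume "i \<in> {h<..Suc k}"
      hence "i = Suc k \<or> i \<in> {h<..k}" by auto
      thus "f i = b - 1 \<and> g i = 0" using h(4)[of i] f g by blast
    qed (use h in simp_all)
  qed
qed simp

lemma radix_adjacentI:
  assumes "h \<in> {1..k}" "\<And>i. i \<in> {1..<h} \<Longrightarrow> f i = g i" "g h = f h + 1"
    "\<And>i. i \<in> {h<..k} \<Longrightarrow> f i = b - 1 \<and> g i = 0" "0 < b"
  shows "radix b g k = radix b f k + 1"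
  using assms(1,4)
proof (induction k)
  case (Suc k)
  show ?case
  proof (cases "h = Suc k")
    case True
    have "radix b f k = radix b g k" by (rule radix_cong) (use assms(2) True in simp)
    thus ?thesis using True assms(3) by simp
  next
    case False
    hence "h \<in> {1..k}" using Suc.prems(1) by simp
    hence "radix b g k = radix b f k + 1" using Suc.IH Suc.prems(2) by simp
    moreover have "f (Suc k) = b - 1 \<and> g (Suc k) = 0" using Suc.prems False by simp
    ultimately show ?thesis using assms(5) by simp
  qed
qed simp

text \<open>Places the cell of a word on the integer grid, so that adjacency of cells becomes
  adjacency of the integers \<open>radix\<close>.\<close>

lemma word_map_eq:
  assumes "0 < n" "0 < m"
  shows "word_map n m w k p =
    ((fst p + real (radix n (fst \<circ> w) k)) / real n ^ k,
     (snd p + real (radix m (snd \<circ> w) k)) / real m ^ k)"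
  using assms
  by (induction k arbitrary: p) (auto simp: bm_map_def field_simps)

lemma word_map_cong:
  "(\<And>i. i \<in> {1..k} \<Longrightarrow> u i = w i) \<Longrightarrow> word_map n m u k = word_map n m w k"
  by (induction k) auto

lemma fiber_count_eq: "fiber_count D j = card {d \<in> D. snd d = j}"
proof -
  have "{d \<in> D. snd d = j} = (\<lambda>i. (i, j)) ` {i. (i, j) \<in> D}" by auto
  thus ?thesis by (simp add: fiber_count_def card_image inj_on_def)
qed

lemma continuous_on_word_map:
  assumes "0 < n" "0 < m" shows "continuous_on UNIV (word_map n m w k)"
  using assms unfolding word_map_eq[OF assms, abs_def] by (intro continuous_intros) auto

section \<open>Carpets and words\<close>

locale bm_carpet =
  fixes n m :: nat and D :: "(nat \<times> nat) set" and E :: "(real \<times> real) set"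
    and \<mu> :: "(real \<times> real) measure"
  assumes m_ge: "2 \<le> m" and m_less: "m < n"
    and D_sub: "D \<subseteq> {0..<n} \<times> {0..<m}" and D_ne: "D \<noteq> {}"
    and carpet: "is_carpet n m D E"
    and bernoulli: "is_uniform_bernoulli n m D E \<mu>"
    and fiber_less: "fiber_count D (m - 1) < fiber_count D 0"
begin

abbreviation S where "S \<equiv> word_map n m"
abbreviation X where "X w k \<equiv> radix n (fst \<circ> w) k"
abbreviation Y where "Y w k \<equiv> radix m (snd \<circ> w) k"
abbreviation "unit_sq \<equiv> {0..1::real} \<times> {0..1::real}"
abbreviation "a \<equiv> fiber_count D"
abbreviation "L \<equiv> ell n m"
abbreviation "lnK \<equiv> ln (real (a 0) / real (a (m - 1)))"

definition words :: "nat \<Rightarrow> (nat \<Rightarrow> nat \<times> nat) set" where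
  "words l = PiE {1..l} (\<lambda>_. D)"

text \<open>For \<open>l = L k\<close> the cells of these words make up one approximate square:
  beyond level \<open>k\<close> only the rows are prescribed. Being a product set, it is counted by
  a product of fiber counts.\<close>

definition cylinder :: "nat \<Rightarrow> nat \<Rightarrow> (nat \<Rightarrow> nat \<times> nat) \<Rightarrow> (nat \<Rightarrow> nat \<times> nat) set" where
  "cylinder k l w = PiE {1..l} (\<lambda>i. if i \<le> k then {w i} else {d \<in> D. snd d = snd (w i)})"

text \<open>Logarithm of the number of words in \<open>cylinder k l w\<close>, for
  \<open>k \<le> l\<close> and letters in \<open>D\<close>. As a sum over digits it lets two rows be
  compared digit by digit.\<close>

definition log_fib :: "nat \<Rightarrow> nat \<Rightarrow> (nat \<Rightarrow> nat \<times> nat) \<Rightarrow> real" where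
  "log_fib k l w = (\<Sum>i\<in>{k<..l}. ln (real (a (snd (w i)))))"

lemma n_ge: "3 \<le> n" using m_ge m_less by simp

lemma pos [simp]: "0 < n" "0 < m" using m_ge m_less by auto

lemma finite_D: "finite D" using D_sub finite_subset by blast

lemma card_D_ge: "1 \<le> card D" using finite_D D_ne by (simp add: Suc_leI card_gt_0_iff)

lemma finite_words: "finite (words l)"
  unfolding words_def by (intro finite_PiE finite_D) auto

lemma digit_less: "d \<in> D \<Longrightarrow> fst d < n" "d \<in> D \<Longrightarrow> snd d < m" using D_sub by auto

lemma fiber_pos: "d \<in> D \<Longrightarrow> 1 \<le> a (snd d)"
proof -
  assume "d \<in> D"
  hence "{d' \<in> D. snd d' = snd d} \<noteq> {}" by blast
  thus ?thesis unfolding fiber_count_eq using finite_D by (simp add: Suc_le_eq card_gt_0_iff)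
qed

lemma fiber_le: "a j \<le> card D"
  unfolding fiber_count_eq using finite_D by (intro card_mono) auto

lemma ln_fiber: "d \<in> D \<Longrightarrow> 0 \<le> ln (real (a (snd d))) \<and> ln (real (a (snd d))) \<le> ln (real (card D))"
  using fiber_pos[of d] fiber_le[of "snd d"] by auto

lemma compact_E: "compact E" and E_ne: "E \<noteq> {}" and E_eq: "E = (\<Union>d\<in>D. bm_map n m d ` E)"
  using carpet by (auto simp: is_carpet_def)

text \<open>A point of \<open>E\<close> where \<open>f\<close> is extremal is itself an image of a
  point of \<open>E\<close>. So the maximum \<open>M\<close> satisfies
  \<open>M \<le> (M + q - 1) / q\<close> and the minimum satisfies
  \<open>M \<ge> M / q\<close>.\<close>

lemma E_coordinate_bound:
  fixes f :: "real \<times> real \<Rightarrow> real" and q :: nat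
  assumes "continuous_on E f" "2 \<le> q"
    and "\<And>d p. d \<in> D \<Longrightarrow> \<exists>c. 0 \<le> c \<and> c \<le> real q - 1 \<and> f (bm_map n m d p) = (f p + c) / real q"
    and "p \<in> E"
  shows "0 \<le> f p \<and> f p \<le> 1"
proof -
  obtain e1 where e1: "e1 \<in> E" "\<And>p. p \<in> E \<Longrightarrow> f p \<le> f e1"
    using continuous_attains_sup[OF compact_E E_ne assms(1)] by blast
  obtain e0 where e0: "e0 \<in> E" "\<And>p. p \<in> E \<Longrightarrow> f e0 \<le> f p"
    using continuous_attains_inf[OF compact_E E_ne assms(1)] by blast
  have q: "real q \<ge> 2" using assms(2) by simp
  obtain d p1 where "d \<in> D" "p1 \<in> E" "e1 = bm_map n m d p1" using e1(1) E_eq by blast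
  then obtain c where c: "c \<le> real q - 1" "f e1 = (f p1 + c) / real q" using assms(3) by blast
  have "f e1 * real q = f p1 + c" using c(2) q by (simp add: field_simps)
  also have "\<dots> \<le> f e1 + (real q - 1)" using e1(2)[OF \<open>p1 \<in> E\<close>] c by simp
  finally have "(f e1 - 1) * (real q - 1) \<le> 0" by (simp add: algebra_simps)
  hence le: "f e1 \<le> 1" using q by (simp add: mult_le_0_iff)
  obtain d p0 where "d \<in> D" "p0 \<in> E" "e0 = bm_map n m d p0" using e0(1) E_eq by blast
  then obtain c where c: "0 \<le> c" "f e0 = (f p0 + c) / real q" using assms(3) by blast
  have "f e0 \<le> f p0 + c" using e0(2)[OF \<open>p0 \<in> E\<close>] c by simp
  also have "\<dots> = f e0 * real q" using c(2) q by (simp add: field_simps)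
  finally have "0 \<le> f e0 * (real q - 1)" by (simp add: algebra_simps)
  hence "0 \<le> f e0" using q by (simp add: zero_le_mult_iff)
  thus ?thesis using le e0(2)[OF \<open>p \<in> E\<close>] e1(2)[OF \<open>p \<in> E\<close>] by linarith
qed

lemma E_sub: "E \<subseteq> unit_sq"
proof
  fix p assume p: "p \<in> E"
  have 1: "0 \<le> fst p \<and> fst p \<le> 1"
  proof (rule E_coordinate_bound[of fst n])
    fix d and p :: "real \<times> real" assume "d \<in> D"
    thus "\<exists>c. 0 \<le> c \<and> c \<le> real n - 1 \<and> fst (bm_map n m d p) = (fst p + c) / real n"
      using digit_less(1)[of d] by (intro exI[of _ "real (fst d)"]) (auto simp: bm_map_def)
  qed (use p n_ge in \<open>auto intro: continuous_intros\<close>)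
  have 2: "0 \<le> snd p \<and> snd p \<le> 1"
  proof (rule E_coordinate_bound[of snd m])
    fix d and p :: "real \<times> real" assume "d \<in> D"
    thus "\<exists>c. 0 \<le> c \<and> c \<le> real m - 1 \<and> snd (bm_map n m d p) = (snd p + c) / real m"
      using digit_less(2)[of d] by (intro exI[of _ "real (snd d)"]) (auto simp: bm_map_def)
  qed (use p m_ge in \<open>auto intro: continuous_intros\<close>)
  from 1 2 show "p \<in> unit_sq" by (cases p) auto
qed

lemma bm_map_E: "d \<in> D \<Longrightarrow> bm_map n m d ` E \<subseteq> E" using E_eq by blast

lemma bm_map_unit:
  assumes "d \<in> D" shows "bm_map n m d ` unit_sq \<subseteq> unit_sq"
proof
  fix p assume "p \<in> bm_map n m d ` unit_sq"
  then obtain q where q: "q \<in> unit_sq" "p = bm_map n m d q" by blast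
  have "real (fst d) + 1 \<le> real n" "real (snd d) + 1 \<le> real m"
    using digit_less[OF assms] by linarith+
  thus "p \<in> unit_sq" using q by (auto simp: bm_map_def divide_simps)
qed

text \<open>Stated for any set that the maps send into itself, since it is needed both for
  \<open>E\<close> and for the unit square.\<close>

lemma S_antimono_aux:
  assumes "\<And>d. d \<in> D \<Longrightarrow> bm_map n m d ` A \<subseteq> A" "\<And>i. i \<in> {1..l} \<Longrightarrow> w i \<in> D" "k \<le> l"
  shows "S w l ` A \<subseteq> S w k ` A"
  using assms(3,2)
proof (induction l rule: dec_induct)
  case (step l)
  have "S w (Suc l) ` A = S w l ` (bm_map n m (w (Suc l)) ` A)" by (simp add: image_comp)
  also have "\<dots> \<subseteq> S w l ` A" using assms(1)[of "w (Suc l)"] step.prems by (intro image_mono) auto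
  also have "\<dots> \<subseteq> S w k ` A" using step by auto
  finally show ?case .
qed simp

lemma S_E_antimono: "(\<And>i. i \<in> {1..l} \<Longrightarrow> w i \<in> D) \<Longrightarrow> k \<le> l \<Longrightarrow> S w l ` E \<subseteq> S w k ` E"
  by (rule S_antimono_aux) (use bm_map_E in auto)

lemma S_unit_antimono:
  "(\<And>i. i \<in> {1..l} \<Longrightarrow> w i \<in> D) \<Longrightarrow> k \<le> l \<Longrightarrow> S w l ` unit_sq \<subseteq> S w k ` unit_sq"
  by (rule S_antimono_aux[OF bm_map_unit])

lemma S_E_sub: "(\<And>i. i \<in> {1..l} \<Longrightarrow> w i \<in> D) \<Longrightarrow> S w l ` E \<subseteq> E"
  using S_E_antimono[of l w 0] by simp

text \<open>The closed rectangle of level \<open>k\<close> horizontally and level \<open>l\<close>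
  vertically. Coordinates are multiplied by the powers, so that comparing two cells becomes
  arithmetic with their integer corners.\<close>

definition in_cell :: "(nat \<Rightarrow> nat \<times> nat) \<Rightarrow> nat \<Rightarrow> nat \<Rightarrow> real \<times> real \<Rightarrow> bool" where
  "in_cell w k l p \<longleftrightarrow>
     real (X w k) \<le> fst p * real n ^ k \<and> fst p * real n ^ k \<le> real (X w k) + 1 \<and>
     real (Y w l) \<le> snd p * real m ^ l \<and> snd p * real m ^ l \<le> real (Y w l) + 1"

lemma S_in_cell_iff: "p \<in> S w k ` unit_sq \<longleftrightarrow> in_cell w k k p"
proof
  assume "p \<in> S w k ` unit_sq"
  thus "in_cell w k k p" by (auto simp: word_map_eq in_cell_def)
next
  assume c: "in_cell w k k p"
  have nz: "real n ^ k \<noteq> 0" "real m ^ k \<noteq> 0" using pos by auto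
  let ?q = "(fst p * real n ^ k - X w k, snd p * real m ^ k - Y w k)"
  have "p = S w k ?q" unfolding word_map_eq[OF pos] using nz by (cases p) auto
  moreover have "?q \<in> unit_sq" using c by (auto simp: in_cell_def)
  ultimately show "p \<in> S w k ` unit_sq" by blast
qed

lemma in_cell_mixed:
  assumes "p \<in> S w l ` unit_sq" "\<And>i. i \<in> {1..l} \<Longrightarrow> w i \<in> D" "k \<le> l" "k' \<le> l"
  shows "in_cell w k k' p"
proof -
  have "in_cell w k k p" "in_cell w k' k' p"
    using subsetD[OF S_unit_antimono[of l w k, OF _ assms(3)] assms(1)]
      subsetD[OF S_unit_antimono[of l w k', OF _ assms(4)] assms(1)] assms(2)
    by (simp_all only: S_in_cell_iff)
  thus ?thesis by (auto simp: in_cell_def)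
qed

lemma S_E_in_cell:
  assumes "p \<in> S w l ` E" "\<And>i. i \<in> {1..l} \<Longrightarrow> w i \<in> D" "k \<le> l" "k' \<le> l"
  shows "in_cell w k k' p"
proof -
  have "p \<in> S w l ` unit_sq" using assms(1) E_sub by blast
  thus ?thesis by (rule in_cell_mixed) (use assms in auto)
qed

lemma in_cell_cong:
  assumes "in_cell w k l p" "\<And>i. i \<in> {1..k} \<Longrightarrow> fst (u i) = fst (w i)"
    "\<And>i. i \<in> {1..l} \<Longrightarrow> snd (u i) = snd (w i)"
  shows "in_cell u k l p"
proof -
  have "X u k = X w k" "Y u l = Y w l" using assms by (auto intro!: radix_cong)
  thus ?thesis using assms(1) by (simp add: in_cell_def)
qed

lemma E_word:
  assumes "p \<in> E" obtains w where "w \<in> words l" "p \<in> S w l ` E"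
  using assms
proof (induction l arbitrary: thesis)
  case 0
  have "(\<lambda>_. undefined) \<in> words 0" by (auto simp: words_def)
  thus ?case using 0 by auto
next
  case (Suc l)
  obtain w q where w: "w \<in> words l" "q \<in> E" "p = S w l q"
    using Suc.IH[OF _ Suc.prems(2)] by blast
  obtain d q' where d: "d \<in> D" "q' \<in> E" "q = bm_map n m d q'" using w(2) E_eq by blast
  let ?w = "w(Suc l := d)"
  have "S ?w l = S w l" by (intro word_map_cong) auto
  hence "p \<in> S ?w (Suc l) ` E" using w d by auto
  moreover have "?w \<in> words (Suc l)" using w(1) d(1) by (auto simp: words_def PiE_def extensional_def)
  ultimately show ?case using Suc.prems(1) by blast
qed

section \<open>Measures of sets by counting words\<close>

lemma prob: "prob_space \<mu>" and sets_mu [simp]: "sets \<mu> = sets borel"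
  and emeasure_compl: "emeasure \<mu> (- E) = 0"
  using bernoulli by (auto simp: is_uniform_bernoulli_def)

lemma space_mu [simp]: "space \<mu> = UNIV"
  using sets_eq_imp_space_eq[OF sets_mu] by simp

sublocale prob_space \<mu> by (rule prob)

lemma self_similar:
  "A \<in> sets borel \<Longrightarrow> measure \<mu> A = (\<Sum>d\<in>D. measure \<mu> (bm_map n m d -` A)) / real (card D)"
  using bernoulli by (auto simp: is_uniform_bernoulli_def)

lemma borel_vimage_S: "A \<in> sets borel \<Longrightarrow> S w l -` A \<in> sets borel"
  using measurable_sets[OF borel_measurable_continuous_onI[OF continuous_on_word_map[OF pos]], of A w l]
  by simp

lemma measure_words:
  assumes "A \<in> sets borel"
  shows "measure \<mu> A = (\<Sum>w\<in>words l. measure \<mu> (S w l -` A)) / real (card D) ^ l"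
proof (induction l)
  case 0
  show ?case by (simp add: words_def)
next
  case (Suc l)
  have "measure \<mu> (S w l -` A) = (\<Sum>d\<in>D. measure \<mu> (S (w(Suc l := d)) (Suc l) -` A)) / real (card D)" for w
  proof -
    have "S (w(Suc l := d)) l = S w l" for d by (intro word_map_cong) auto
    thus ?thesis using self_similar[OF borel_vimage_S[OF assms]] by (simp add: vimage_comp)
  qed
  hence "(\<Sum>w\<in>words l. measure \<mu> (S w l -` A)) =
      (\<Sum>w\<in>words l. \<Sum>d\<in>D. measure \<mu> (S (w(Suc l := d)) (Suc l) -` A)) / real (card D)"
    by (simp add: sum_divide_distrib)
  also have "(\<Sum>w\<in>words l. \<Sum>d\<in>D. measure \<mu> (S (w(Suc l := d)) (Suc l) -` A)) =
      (\<Sum>(d, w)\<in>D \<times> words l. measure \<mu> (S (w(Suc l := d)) (Suc l) -` A))"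
    by (subst sum.swap) (simp add: sum.cartesian_product)
  also have "\<dots> = (\<Sum>w\<in>words (Suc l). measure \<mu> (S w (Suc l) -` A))"
  proof -
    \<comment> \<open>Appending a last letter is a bijection from \<open>D \<times> words l\<close>
      to \<open>words (Suc l)\<close>.\<close>
    have ins: "{1..Suc l} = insert (Suc l) {1..l}" by auto
    have "words (Suc l) = (\<lambda>(d, w). w(Suc l := d)) ` (D \<times> words l)"
      unfolding words_def ins PiE_insert_eq by simp
    moreover have "inj_on (\<lambda>(d, w). w(Suc l := d)) (D \<times> words l)"
      unfolding words_def by (rule inj_combinator) auto
    ultimately show ?thesis by (simp only: sum.reindex) (simp add: case_prod_beta o_def)
  qed
  finally show ?case using Suc by (simp del: word_map.simps add: mult.commute)
qed

text \<open>Holds because \<open>E\<close> has full mass. Words whose piece straddles the boundary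
  of \<open>A\<close> stay undetermined; for the bounds below any value between 0 and 1 will
  do.\<close>

lemma measure_S_vimage:
  assumes "A \<in> sets borel"
  shows "S w l ` E \<subseteq> A \<Longrightarrow> measure \<mu> (S w l -` A) = 1"
    and "S w l ` E \<inter> A = {} \<Longrightarrow> measure \<mu> (S w l -` A) = 0"
proof -
  have E: "E \<in> sets borel" using compact_E by (simp add: borel_compact)
  have B: "S w l -` A \<in> sets borel" by (rule borel_vimage_S[OF assms])
  have null: "measure \<mu> (- E) = 0" using emeasure_compl by (simp add: measure_def)
  {
    assume "S w l ` E \<subseteq> A"
    hence "E \<subseteq> S w l -` A" by auto
    hence "measure \<mu> E \<le> measure \<mu> (S w l -` A)" using B E by (intro finite_measure_mono) auto
    moreover have "measure \<mu> E = 1"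
      using prob_compl[of E] null E by (simp add: Compl_eq_Diff_UNIV)
    ultimately show "measure \<mu> (S w l -` A) = 1" using prob_le_1[of "S w l -` A"] by simp
  }
  {
    assume "S w l ` E \<inter> A = {}"
    hence "S w l -` A \<subseteq> - E" by auto
    hence "measure \<mu> (S w l -` A) \<le> measure \<mu> (- E)" using E by (intro finite_measure_mono) auto
    thus "measure \<mu> (S w l -` A) = 0" using null measure_nonneg[of \<mu>] by (simp add: antisym)
  }
qed

lemma card_cylinder:
  assumes "\<And>i. i \<in> {1..l} \<Longrightarrow> w i \<in> D" "k \<le> l"
  shows "real (card (cylinder k l w)) = exp (log_fib k l w)"
proof -
  have "card (cylinder k l w) = (\<Prod>i\<in>{1..l}. if i \<le> k then 1 else a (snd (w i)))"
    unfolding cylinder_def by (subst card_PiE) (auto simp: fiber_count_eq intro!: prod.cong)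
  also have "\<dots> = (\<Prod>i\<in>{k<..l}. a (snd (w i)))"
    using assms(2) by (intro prod.mono_neutral_cong_right) auto
  finally have "real (card (cylinder k l w)) = (\<Prod>i\<in>{k<..l}. real (a (snd (w i))))" by simp
  moreover have "exp (log_fib k l w) = (\<Prod>i\<in>{k<..l}. exp (ln (real (a (snd (w i))))))"
    unfolding log_fib_def by (rule exp_sum) simp
  moreover have "\<dots> = (\<Prod>i\<in>{k<..l}. real (a (snd (w i))))"
  proof (rule prod.cong)
    fix i assume "i \<in> {k<..l}"
    hence "w i \<in> D" using assms(1) by simp
    thus "exp (ln (real (a (snd (w i))))) = real (a (snd (w i)))" using fiber_pos[of "w i"] by simp
  qed simp
  ultimately show ?thesis by (simp only:)
qed

lemma cylinder_sub_words:
  assumes "\<And>i. i \<in> {1..l} \<Longrightarrow> w i \<in> D" shows "cylinder k l w \<subseteq> words l"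
  unfolding cylinder_def words_def using assms by (intro PiE_mono) auto

lemma measure_lower:
  assumes "A \<in> sets borel" "\<And>i. i \<in> {1..l} \<Longrightarrow> u i \<in> D" "k \<le> l"
    and "\<And>w. w \<in> cylinder k l u \<Longrightarrow> S w l ` E \<subseteq> A"
  shows "exp (log_fib k l u) / real (card D) ^ l \<le> measure \<mu> A"
proof -
  have "exp (log_fib k l u) = (\<Sum>w\<in>cylinder k l u. measure \<mu> (S w l -` A))"
    using measure_S_vimage(1)[OF assms(1)] assms(4) card_cylinder[of l u k, OF assms(2,3)] by simp
  also have "\<dots> \<le> (\<Sum>w\<in>words l. measure \<mu> (S w l -` A))"
    using cylinder_sub_words[of l u k, OF assms(2)] finite_words by (intro sum_mono2) auto
  finally show ?thesis by (subst measure_words[OF assms(1), of l]) (rule divide_right_mono, auto)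
qed

text \<open>Words meeting \<open>A\<close> are grouped by the position of their cell. A position
  determines the column digits up to \<open>k\<close> and the row digits up to \<open>l\<close>, so
  each group lies in one cylinder, and at most 3 x 3 positions occur. For \<open>x = 0\<close> the
  truncated \<open>x - 1\<close> only shrinks the range.\<close>

lemma measure_upper:
  fixes x y :: nat
  assumes "A \<in> sets borel" "k \<le> l"
    and "\<And>w. w \<in> words l \<Longrightarrow> S w l ` E \<inter> A \<noteq> {} \<Longrightarrow>
      X w k \<in> {x - 1..x + 1} \<and> Y w l \<in> {y - 1..y + 1} \<and> log_fib k l w \<le> M"
  shows "measure \<mu> A \<le> 9 * exp M / real (card D) ^ l"
proof -
  define W where "W = {w \<in> words l. S w l ` E \<inter> A \<noteq> {}}"
  define G where "G = (\<lambda>(x', y'). {w \<in> W. X w k = x' \<and> Y w l = y'})"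
  define I where "I = {x - 1..x + 1} \<times> {y - 1..y + 1}"
  have finW: "finite W" unfolding W_def using finite_words by simp
  have cardG: "real (card (G q)) \<le> exp M" if "q \<in> I" for q
  proof (cases "G q = {}")
    case False
    then obtain w0 where w0: "w0 \<in> G q" by blast
    hence w0': "w0 \<in> words l" "log_fib k l w0 \<le> M" and W0: "w0 \<in> W"
      using assms(3) by (auto simp: G_def W_def split: prod.splits)
    have D0: "\<And>i. i \<in> {1..l} \<Longrightarrow> w0 i \<in> D" using w0'(1) by (auto simp: words_def PiE_def)
    have "G q \<subseteq> cylinder k l w0"
    proof
      fix w assume "w \<in> G q"
      hence w: "w \<in> words l" "X w k = X w0 k" "Y w l = Y w0 l"
        using w0 by (auto simp: G_def W_def split: prod.splits)
      have Dw: "\<And>i. i \<in> {1..l} \<Longrightarrow> w i \<in> D" using w(1) by (auto simp: words_def PiE_def)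
      have y: "snd (w i) = snd (w0 i)" if "i \<in> {1..l}" for i
        using radix_inj[OF w(3), of i] Dw D0 digit_less that by (auto simp: o_def)
      have x: "fst (w i) = fst (w0 i)" if "i \<in> {1..k}" for i
        using radix_inj[OF w(2), of i] Dw D0 digit_less that assms(2) by (auto simp: o_def)
      have "w i \<in> (if i \<le> k then {w0 i} else {d \<in> D. snd d = snd (w0 i)})" if "i \<in> {1..l}" for i
        using x[of i] y[of i] Dw[of i] that by (auto simp: prod_eq_iff)
      moreover have "w \<in> extensional {1..l}" using w(1) by (auto simp: words_def PiE_def)
      ultimately show "w \<in> cylinder k l w0" by (auto simp: cylinder_def PiE_def)
    qed
    moreover have "finite (cylinder k l w0)"
      by (rule finite_subset[OF cylinder_sub_words[of l w0 k, OF D0] finite_words])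
    ultimately have "card (G q) \<le> card (cylinder k l w0)" by (intro card_mono)
    hence "real (card (G q)) \<le> exp (log_fib k l w0)" using card_cylinder[of l w0 k, OF D0 assms(2)] by simp
    thus ?thesis using w0'(2) by (meson exp_le_cancel_iff order_trans)
  qed simp
  have "W \<subseteq> (\<Union>q\<in>I. G q)"
  proof
    fix w assume "w \<in> W"
    moreover from this have "(X w k, Y w l) \<in> I" using assms(3)[of w] unfolding W_def I_def by blast
    ultimately show "w \<in> (\<Union>q\<in>I. G q)" unfolding G_def by blast
  qed
  moreover have "finite (\<Union>q\<in>I. G q)" using finW by (auto simp: G_def I_def)
  ultimately have "card W \<le> card (\<Union>q\<in>I. G q)" by (intro card_mono)
  also have "\<dots> \<le> (\<Sum>q\<in>I. card (G q))" by (rule card_UN_le) (simp add: I_def)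
  finally have "real (card W) \<le> (\<Sum>q\<in>I. real (card (G q)))"
    by (metis of_nat_mono of_nat_sum)
  also have "\<dots> \<le> (\<Sum>q\<in>I. exp M)" by (intro sum_mono cardG)
  also have "\<dots> = real (card I) * exp M" by simp
  also have "\<dots> \<le> 9 * exp M"
  proof -
    have "card I \<le> 3 * 3" unfolding I_def card_cartesian_product by (intro mult_mono) auto
    thus ?thesis by (intro mult_right_mono) auto
  qed
  finally have W9: "real (card W) \<le> 9 * exp M" .
  have "(\<Sum>w\<in>words l. measure \<mu> (S w l -` A)) = (\<Sum>w\<in>W. measure \<mu> (S w l -` A))"
    using measure_S_vimage(2)[OF assms(1)] finite_words
    by (intro sum.mono_neutral_right) (auto simp: W_def)
  also have "\<dots> \<le> (\<Sum>w\<in>W. 1)" by (intro sum_mono) (rule prob_le_1)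
  finally have "(\<Sum>w\<in>words l. measure \<mu> (S w l -` A)) \<le> 9 * exp M" using W9 by simp
  thus ?thesis by (subst measure_words[OF assms(1), of l]) (rule divide_right_mono, auto)
qed

section \<open>Neighbouring rows and the reverse run length\<close>

lemma ell_le: "real (L k) \<le> real k / bm_sigma n m"
  and ell_gt: "real k / bm_sigma n m < real (L k) + 1"
proof -
  have "0 \<le> real k / bm_sigma n m" unfolding bm_sigma_def using m_ge m_less by simp
  thus "real (L k) \<le> real k / bm_sigma n m" "real k / bm_sigma n m < real (L k) + 1"
    unfolding ell_def by linarith+
qed

lemma sigma_inverse_gt: "1 < 1 / bm_sigma n m"
  unfolding bm_sigma_def using m_ge m_less by (simp add: field_simps)

text \<open>Cells of levels \<open>k\<close> and \<open>L k\<close> are square up to a factor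
  \<open>m\<close>; this is how \<open>ell\<close> enters the geometry.\<close>

lemma power_ell_le: "real m ^ L k \<le> real n ^ k"
  and power_ell_gt: "real n ^ k < real m * real m ^ L k"
proof -
  have m1: "1 < real m" "1 < real n" using m_ge m_less by auto
  have "real (L k) * ln (real m) \<le> real k * ln (real n)"
    using ell_le[of k] m1 by (simp add: bm_sigma_def field_simps)
  hence "ln (real m ^ L k) \<le> ln (real n ^ k)" using m1 by (simp add: ln_realpow)
  thus "real m ^ L k \<le> real n ^ k" using m1 by (subst (asm) ln_le_cancel_iff) auto
  have "real k * ln (real n) < real (Suc (L k)) * ln (real m)"
    using ell_gt[of k] m1 by (simp add: bm_sigma_def field_simps)
  hence "ln (real n ^ k) < ln (real m ^ Suc (L k))" using m1 by (simp only: ln_realpow)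
  hence "real n ^ k < real m ^ Suc (L k)" using m1 by (subst (asm) ln_less_cancel_iff) auto
  thus "real n ^ k < real m * real m ^ L k" by simp
qed

lemma ell_ge: "k \<le> L k"
proof -
  have "real k * 1 \<le> real k * (1 / bm_sigma n m)"
    using sigma_inverse_gt by (intro mult_left_mono) auto
  thus ?thesis using ell_gt[of k] by simp
qed

lemma ell_mono: "j \<le> k \<Longrightarrow> L j \<le> L k"
  unfolding ell_def bm_sigma_def using m_ge m_less
  by (intro nat_mono floor_mono divide_right_mono) auto

lemma fiber_bot_pos: "1 \<le> a 0" using fiber_less by simp

text \<open>If row \<open>m - 1\<close> is empty, the quotient is \<open>x / 0 = 0\<close> and \<open>lnK = ln 0 = 0\<close>. This fits:
  carries then never occur between occupied rows, so neighbouring rows have comparable mass.\<close>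

lemma lnK_nonneg: "0 \<le> lnK"
proof (cases "a (m - 1) = 0")
  case False
  hence "1 \<le> real (a 0) / real (a (m - 1))" using fiber_less by (simp add: field_simps)
  thus ?thesis by (rule ln_ge_zero)
qed simp

lemma lnN_nonneg: "0 \<le> ln (real (card D))" using card_D_ge by simp

lemma log_fib_cong:
  "(\<And>i. i \<in> {k<..l} \<Longrightarrow> snd (u i) = snd (w i)) \<Longrightarrow> log_fib k l u = log_fib k l w"
  unfolding log_fib_def by (intro sum.cong) auto

lemma log_fib_split: "j \<le> k \<Longrightarrow> k \<le> l \<Longrightarrow> log_fib j l w = log_fib j k w + log_fib k l w"
  unfolding log_fib_def by (subst sum.union_disjoint[symmetric]) (auto intro!: sum.cong)

lemma log_fib_bounds:
  assumes "\<And>i. i \<in> {1..l} \<Longrightarrow> w i \<in> D"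
  shows "0 \<le> log_fib k l w" "log_fib k l w \<le> real (l - k) * ln (real (card D))"
proof -
  have "0 \<le> ln (real (a (snd (w i)))) \<and> ln (real (a (snd (w i)))) \<le> ln (real (card D))"
    if "i \<in> {k<..l}" for i
    using ln_fiber[of "w i"] assms that by simp
  thus "0 \<le> log_fib k l w" "log_fib k l w \<le> real (l - k) * ln (real (card D))"
    unfolding log_fib_def using sum_bounded_above[of "{k<..l}" "\<lambda>i. ln (real (a (snd (w i))))"]
    by (auto intro: sum_nonneg)
qed

lemma same_row:
  assumes "\<And>i. i \<in> {1..l} \<Longrightarrow> u i \<in> D" "\<And>i. i \<in> {1..l} \<Longrightarrow> w i \<in> D"
    and "Y u l = Y w l" "i \<in> {1..l}"
  shows "snd (u i) = snd (w i)"
  using radix_inj[OF assms(3), of i] digit_less(2) assms(1,2,4) by simp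

text \<open>Digits before the carry position \<open>h\<close> cancel, the digit at \<open>h\<close>
  costs at most \<open>ln (card D)\<close>, and each digit beyond both \<open>h\<close> and
  \<open>k\<close> trades row \<open>m - 1\<close> for row 0, a gain of \<open>lnK\<close>. So, up
  to a constant, the upper row is never the lighter one.\<close>

lemma log_fib_adjacent:
  assumes u: "\<And>i. i \<in> {1..l} \<Longrightarrow> u i \<in> D" and v: "\<And>i. i \<in> {1..l} \<Longrightarrow> v i \<in> D"
    and row: "Y v l = Y u l + 1"
  obtains h where "h \<in> {1..l}" "snd (v h) = snd (u h) + 1"
    "\<forall>i\<in>{1..<h}. snd (u i) = snd (v i)"
    "\<forall>i\<in>{h<..l}. snd (u i) = m - 1 \<and> snd (v i) = 0"
    "\<bar>log_fib k l v - log_fib k l u - real (l - max k h) * lnK\<bar> \<le> ln (real (card D))"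
proof -
  obtain h where h: "h \<in> {1..l}" "\<And>i. i \<in> {1..<h} \<Longrightarrow> snd (u i) = snd (v i)"
    "snd (v h) = snd (u h) + 1" "\<And>i. i \<in> {h<..l} \<Longrightarrow> snd (u i) = m - 1 \<and> snd (v i) = 0"
    using radix_adjacent[OF row] digit_less(2) u v by (auto simp: o_def)
  define d where "d i = ln (real (a (snd (v i)))) - ln (real (a (snd (u i))))" for i
  have "log_fib k l v - log_fib k l u = (\<Sum>i\<in>{k<..l}. d i)"
    unfolding log_fib_def d_def by (rule sum_subtractf[symmetric])
  also have "\<dots> = (\<Sum>i\<in>{k<..l} \<inter> {..h}. d i) + (\<Sum>i\<in>{k<..l} - {..h}. d i)"
    by (rule sum.Int_Diff) simp
  also have "(\<Sum>i\<in>{k<..l} - {..h}. d i) = (\<Sum>i\<in>{k<..l} - {..h}. lnK)"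
  proof (rule sum.cong)
    fix i assume i: "i \<in> {k<..l} - {..h}"
    hence "u i \<in> D" "snd (u i) = m - 1" "snd (v i) = 0" using u h(4)[of i] by auto
    \<comment> \<open>A digit of \<open>u\<close> lies in row \<open>m - 1\<close>, so here
      \<open>lnK\<close> is a genuine difference of logarithms and not the default value.\<close>
    moreover from this have "1 \<le> a (m - 1)" using fiber_pos[of "u i"] by simp
    ultimately show "d i = lnK" unfolding d_def using fiber_bot_pos by (simp add: ln_div)
  qed simp
  also have "{k<..l} - {..h} = {max k h<..l}" by auto
  also have "(\<Sum>i\<in>{max k h<..l}. lnK) = real (l - max k h) * lnK" by simp
  also have "(\<Sum>i\<in>{k<..l} \<inter> {..h}. d i) = (\<Sum>i\<in>{k<..l} \<inter> {h}. d i)"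
  proof (rule sum.mono_neutral_right)
    show "\<forall>i\<in>{k<..l} \<inter> {..h} - {k<..l} \<inter> {h}. d i = 0"
    proof
      fix i assume "i \<in> {k<..l} \<inter> {..h} - {k<..l} \<inter> {h}"
      hence "i \<in> {1..<h}" by auto
      thus "d i = 0" using h(2)[of i] by (simp add: d_def)
    qed
  qed auto
  finally have eq: "log_fib k l v - log_fib k l u - real (l - max k h) * lnK = (\<Sum>i\<in>{k<..l} \<inter> {h}. d i)"
    by simp
  have "\<bar>d h\<bar> \<le> ln (real (card D))"
    using ln_fiber[OF u[OF h(1)]] ln_fiber[OF v[OF h(1)]] unfolding d_def by linarith
  hence "\<bar>\<Sum>i\<in>{k<..l} \<inter> {h}. d i\<bar> \<le> ln (real (card D))"
    using lnN_nonneg by (cases "h \<in> {k<..l}") auto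
  thus ?thesis using that[OF h(1,3)] h(2,4) eq by simp
qed

lemma last_non_eq:
  assumes "h \<in> {1..L k}" "snd (w h) \<noteq> p" "\<And>i. i \<in> {h<..L k} \<Longrightarrow> snd (w i) = p"
  shows "last_non n m p k w = h"
proof -
  define H where "H = {h. 1 \<le> h \<and> h \<le> L k \<and> snd (w h) \<noteq> p}"
  have "finite H" unfolding H_def by (rule finite_subset[of _ "{..L k}"]) auto
  moreover have "h \<in> H" using assms by (auto simp: H_def)
  moreover have "i \<le> h" if "i \<in> H" for i using assms(3)[of i] that by (fastforce simp: H_def)
  ultimately have "Max H = h" by (intro Max_eqI)
  moreover have "H \<noteq> {}" using \<open>h \<in> H\<close> by blast
  ultimately show ?thesis unfolding last_non_def H_def[symmetric] Let_def by simp
qed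

lemma digit_row_set: "d \<in> D \<Longrightarrow> snd d \<in> row_set D"
  using fiber_pos[of d] by (simp add: row_set_def)

text \<open>The carry stops at the last nonzero digit of \<open>\<omega>\<close>, which is
  \<open>last_non n m 0 k \<omega>\<close>. The side condition in \<open>beta_bot\<close> holds
  because at that position \<open>w\<close> uses the row one below.\<close>

lemma row_below:
  assumes w: "\<And>i. i \<in> {1..L k} \<Longrightarrow> w i \<in> D" and \<omega>: "\<And>i. i \<in> {1..L k} \<Longrightarrow> \<omega> i \<in> D"
    and row: "Y \<omega> (L k) = Y w (L k) + 1"
  shows "\<bar>log_fib k (L k) \<omega> - log_fib k (L k) w - real (beta_bot n m D k \<omega>) * lnK\<bar> \<le> ln (real (card D))"
proof -
  obtain h where h: "h \<in> {1..L k}" "snd (\<omega> h) = snd (w h) + 1"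
    "\<forall>i\<in>{h<..L k}. snd (w i) = m - 1 \<and> snd (\<omega> i) = 0"
    "\<bar>log_fib k (L k) \<omega> - log_fib k (L k) w - real (L k - max k h) * lnK\<bar> \<le> ln (real (card D))"
    by (rule log_fib_adjacent[where u = w and v = \<omega> and l = "L k" and k = k, OF w \<omega> row]) blast
  have "last_non n m 0 k \<omega> = h" by (rule last_non_eq) (use h(1-3) in auto)
  moreover have "snd (\<omega> h) \<in> (\<lambda>j. j + 1) ` row_set D" using digit_row_set w h(1,2) by blast
  ultimately have "beta_bot n m D k \<omega> = L k - max k h" using h(1) by (simp add: beta_bot_def)
  thus ?thesis using h(4) by simp
qed

text \<open>Mirror image of \<open>row_below\<close>: now \<open>\<omega>\<close> is the lower row,
  and the carry stops at its last digit other than \<open>m - 1\<close>.\<close>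

lemma row_above:
  assumes w: "\<And>i. i \<in> {1..L k} \<Longrightarrow> w i \<in> D" and \<omega>: "\<And>i. i \<in> {1..L k} \<Longrightarrow> \<omega> i \<in> D"
    and row: "Y w (L k) = Y \<omega> (L k) + 1"
  shows "\<bar>log_fib k (L k) w - log_fib k (L k) \<omega> - real (beta_top n m D k \<omega>) * lnK\<bar> \<le> ln (real (card D))"
proof -
  obtain h where h: "h \<in> {1..L k}" "snd (w h) = snd (\<omega> h) + 1"
    "\<forall>i\<in>{h<..L k}. snd (\<omega> i) = m - 1 \<and> snd (w i) = 0"
    "\<bar>log_fib k (L k) w - log_fib k (L k) \<omega> - real (L k - max k h) * lnK\<bar> \<le> ln (real (card D))"
    by (rule log_fib_adjacent[where u = \<omega> and v = w and l = "L k" and k = k, OF \<omega> w row]) blast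
  have "snd (\<omega> h) < m - 1" using digit_less(2)[OF w[OF h(1)]] h(2) by simp
  hence "last_non n m (m - 1) k \<omega> = h" by (intro last_non_eq) (use h(1,3) in auto)
  moreover have "snd (\<omega> h) + 1 \<in> row_set D" using digit_row_set[OF w[OF h(1)]] h(2) by simp
  ultimately have "beta_top n m D k \<omega> = L k - max k h" using h(1) by (simp add: beta_top_def)
  thus ?thesis using h(4) by simp
qed

lemma beta_bot_eq_0: "1 \<le> k \<Longrightarrow> snd (\<omega> (L k)) \<noteq> 0 \<Longrightarrow> beta_bot n m D k \<omega> = 0"
  using last_non_eq[of "L k" k \<omega> 0] ell_ge[of k] by (simp add: beta_bot_def Let_def)

lemma beta_top_eq_0: "1 \<le> k \<Longrightarrow> snd (\<omega> (L k)) \<noteq> m - 1 \<Longrightarrow> beta_top n m D k \<omega> = 0"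
  using last_non_eq[of "L k" k \<omega> "m - 1"] ell_ge[of k] by (simp add: beta_top_def Let_def)

text \<open>As \<open>m \<ge> 2\<close>, the digit at \<open>L k\<close> differs from 0 or from
  \<open>m - 1\<close>, and the corresponding run is empty. The sum is what appears when the bounds
  for the rows above and below are subtracted.\<close>

lemma beta_eq_sum: "1 \<le> k \<Longrightarrow> beta n m D k \<omega> = beta_bot n m D k \<omega> + beta_top n m D k \<omega>"
  using beta_bot_eq_0[of k \<omega>] beta_top_eq_0[of k \<omega>] m_ge by (cases "snd (\<omega> (L k)) = 0") (auto simp: beta_def)

lemma beta_le: "beta n m D k \<omega> \<le> L k - k"
  by (auto simp: beta_def beta_bot_def beta_top_def Let_def)

section \<open>Measures of balls\<close>

lemma borel_ball_Int_E: "ball z r \<inter> E \<in> sets borel"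
  using compact_E by (intro sets.Int) (auto simp: borel_compact)

lemma dist_le_coordinates: "dist p q \<le> \<bar>fst p - fst q\<bar> + \<bar>snd p - snd q\<bar>" for p q :: "real \<times> real"
  using sqrt_sum_squares_le_sum_abs[of "fst p - fst q" "snd p - snd q"]
  by (simp add: dist_prod_def dist_real_def)

lemma coordinates_le_dist:
  "\<bar>fst p - fst q\<bar> \<le> dist p q" "\<bar>snd p - snd q\<bar> \<le> dist p q" for p q :: "real \<times> real"
  using dist_fst_le[of p q] dist_snd_le[of p q] by (simp_all add: dist_real_def)

lemma interval_scaled:
  fixes x y b c e :: real
  assumes "0 < b" "c \<le> x * b" "x * b \<le> c + e" "c \<le> y * b" "y * b \<le> c + e"
  shows "\<bar>x - y\<bar> \<le> e / b"
proof -
  have "\<bar>x - y\<bar> * b = \<bar>x * b - y * b\<bar>" using assms(1) by (simp add: left_diff_distrib[symmetric] abs_mult)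
  also have "\<dots> \<le> e" using assms by linarith
  finally show ?thesis using assms(1) by (simp add: field_simps)
qed

lemma in_cell_dist:
  assumes "in_cell w k l p" "in_cell w k l q"
  shows "dist p q \<le> 1 / real n ^ k + 1 / real m ^ l"
proof -
  have "\<bar>fst p - fst q\<bar> \<le> 1 / real n ^ k" "\<bar>snd p - snd q\<bar> \<le> 1 / real m ^ l"
    using assms by (auto simp: in_cell_def intro!: interval_scaled)
  thus ?thesis using dist_le_coordinates[of p q] by linarith
qed

lemma cylinder_in_cell:
  assumes "w \<in> cylinder k l u" "\<And>i. i \<in> {1..l} \<Longrightarrow> u i \<in> D" "p \<in> S w l ` E" "j \<le> k" "k \<le> l"
  shows "in_cell u j l p"
proof -
  have w: "w i \<in> (if i \<le> k then {u i} else {d \<in> D. snd d = snd (u i)})" if "i \<in> {1..l}" for i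
    using assms(1) that unfolding cylinder_def by (rule PiE_mem)
  have wD: "w i \<in> D" if "i \<in> {1..l}" for i
    using w[OF that] assms(2)[OF that] by (auto split: if_splits)
  have wu: "snd (u i) = snd (w i)" if "i \<in> {1..l}" for i
    using w[OF that] by (auto split: if_splits)
  have "in_cell w j l p" by (rule S_E_in_cell[OF assms(3) wD]) (use assms in auto)
  thus ?thesis
  proof (rule in_cell_cong[OF _ _ wu])
    fix i assume "i \<in> {1..j}"
    thus "fst (u i) = fst (w i)" using w[of i] assms(4,5) by simp
  qed
qed

lemma cylinder_S_E_sub:
  assumes "w \<in> cylinder k l u" "\<And>i. i \<in> {1..l} \<Longrightarrow> u i \<in> D"
  shows "S w l ` E \<subseteq> E"
proof (rule S_E_sub)
  have "w \<in> words l" using cylinder_sub_words[of l u k] assms by blast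
  thus "w i \<in> D" if "i \<in> {1..l}" for i using that by (auto simp: words_def PiE_def)
qed

lemma words_D: "w \<in> words l \<Longrightarrow> i \<in> {1..l} \<Longrightarrow> w i \<in> D"
  by (auto simp: words_def PiE_def)

lemma inverse_power_small:
  assumes "0 < e" obtains c where "(1 / real m) ^ c < e"
  using real_arch_pow_inv[OF assms, of "1 / real m"] m_ge by auto

lemma n_power_ge: "1 / real n ^ k \<le> 1 / real m ^ k"
  using m_less m_ge by (intro divide_left_mono power_mono) auto

text \<open>Makes all quotients of ball masses and their logarithms genuine. With equal levels the
  cylinder consists of a single word.\<close>

lemma measure_ball_pos:
  assumes "z \<in> E" "0 < r" shows "0 < measure \<mu> (ball z r \<inter> E)"
proof -
  obtain l where l: "(1 / real m) ^ l < r / 2" using inverse_power_small[of "r / 2"] assms(2) by auto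
  obtain w where w: "w \<in> words l" "z \<in> S w l ` E" using E_word[OF assms(1)] by blast
  have wD: "\<And>i. i \<in> {1..l} \<Longrightarrow> w i \<in> D" using words_D[OF w(1)] .
  have "exp (log_fib l l w) / real (card D) ^ l \<le> measure \<mu> (ball z r \<inter> E)"
  proof (rule measure_lower[OF borel_ball_Int_E wD])
    fix w' assume w': "w' \<in> cylinder l l w"
    have "p \<in> ball z r" if "p \<in> S w' l ` E" for p
    proof -
      have "dist z p \<le> 1 / real n ^ l + 1 / real m ^ l"
        using cylinder_in_cell[OF w' wD that, of l] S_E_in_cell[OF w(2) wD, of l l]
        by (intro in_cell_dist) auto
      also have "\<dots> < r" using n_power_ge[of l] l by (simp add: power_one_over)
      finally show ?thesis by simp
    qed
    thus "S w' l ` E \<subseteq> ball z r \<inter> E" using cylinder_S_E_sub[OF w' wD] by blast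
  qed auto
  moreover have "0 < exp (log_fib l l w) / real (card D) ^ l" using card_D_ge by simp
  ultimately show ?thesis by linarith
qed

lemma near_interval:
  fixes x y :: real and i j :: nat
  assumes "real i \<le> x" "x \<le> real i + 1" "real j \<le> y" "y \<le> real j + 1" "\<bar>x - y\<bar> < 1"
  shows "i \<in> {j - 1..j + 1}"
proof -
  have "real i < real j + 2" "real j < real i + 2" using assms by linarith+
  thus ?thesis by auto
qed

lemma near_scaled:
  fixes x y b r :: real
  assumes "\<bar>x - y\<bar> < r" "0 < b" "r * b \<le> c" shows "\<bar>x * b - y * b\<bar> < c"
proof -
  have "\<bar>x * b - y * b\<bar> = \<bar>x - y\<bar> * b" using assms(2) by (simp add: left_diff_distrib[symmetric] abs_mult)
  also have "\<dots> < r * b" using assms by simp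
  finally show ?thesis using assms by simp
qed

lemma coding_in_cell:
  assumes "is_coding n m D \<omega> z" "1 \<le> l" "k \<le> l"
  shows "in_cell \<omega> k l z"
proof -
  have "z \<in> S \<omega> l ` unit_sq" using assms by (auto simp: is_coding_def)
  moreover have "\<omega> i \<in> D" if "i \<in> {1..l}" for i
    using assms(1) that by (auto simp: is_coding_def digit_seqs_def)
  ultimately show ?thesis using assms(3) in_cell_mixed[of z \<omega> l k l] by blast
qed

section \<open>Upper bounds for mass ratios of balls\<close>

definition ratio :: "real \<Rightarrow> real \<Rightarrow> real \<times> real \<Rightarrow> real \<times> real \<Rightarrow> real" where
  "ratio \<rho> r z z' = measure \<mu> (ball z r \<inter> E) / measure \<mu> (ball z' (\<rho> * r) \<inter> E)"

text \<open>That many levels further down, a cell at scale \<open>k\<close> has diameter at most \<open>\<rho> / n ^ (k + 1)\<close>.\<close>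

definition extra_depth :: "real \<Rightarrow> nat" where
  "extra_depth \<rho> = (SOME c. (1 / real m) ^ c < \<rho> / (real n * (1 + real m)))"

text \<open>The 9 is that of \<open>measure_upper\<close>. Going \<open>extra_depth\<close> levels
  down costs that many \<open>ln (card D)\<close> twice: once in the normalisation by
  \<open>card D ^ l\<close>, once for the digits dropped from \<open>log_fib\<close>.\<close>

definition ratio_const :: "real \<Rightarrow> real" where
  "ratio_const \<rho> = ln 9 + 2 * real (extra_depth \<rho>) * ln (real (card D))"

lemma ratio_const_nonneg: "0 \<le> ratio_const \<rho>"
  unfolding ratio_const_def using lnN_nonneg by simp

text \<open>The ball around \<open>z\<close> meets at most nine positions of cells. The ball around
  \<open>z'\<close> contains a cylinder \<open>c\<close> levels deeper, whose prefix obeys the same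
  bounds because \<open>z'\<close> lies in the large ball. Keeping \<open>lo\<close> and
  \<open>hi\<close> abstract permits two uses: with run lengths in \<open>index_upper\<close>,
  without them in \<open>index_not_V\<close>.\<close>

lemma ratio_upper:
  assumes \<rho>: "0 < \<rho>" and cod: "is_coding n m D \<omega> z" and z: "z \<in> E" and k: "1 \<le> k"
    and r: "r \<le> 1 / real n ^ k" "1 / real n ^ Suc k < r" and z': "z' \<in> E" "z' \<in> ball z r"
    and lohi: "\<And>w. \<lbrakk>w \<in> words (L k); S w (L k) ` E \<inter> ball z r \<noteq> {};
             Y w (L k) \<in> {Y \<omega> (L k) - 1..Y \<omega> (L k) + 1}\<rbrakk>
         \<Longrightarrow> lo \<le> log_fib k (L k) w \<and> log_fib k (L k) w \<le> hi"
  shows "ln (ratio \<rho> r z z') \<le> hi - lo + ratio_const \<rho>"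
proof -
  define N where "N = real (card D)"
  have N: "1 \<le> N" "0 \<le> ln N" unfolding N_def using card_D_ge lnN_nonneg by auto
  define c where "c = extra_depth \<rho>"
  have "\<exists>c. (1 / real m) ^ c < \<rho> / (real n * (1 + real m))"
    using inverse_power_small[of "\<rho> / (real n * (1 + real m))"] \<rho> by auto
  hence c: "(1 / real m) ^ c < \<rho> / (real n * (1 + real m))"
    unfolding c_def extra_depth_def by (rule someI_ex)
  \<comment> \<open>The summand with \<open>real m\<close> accounts for the height of a cell, which
    is less than \<open>m\<close> times its width.\<close>
  have c': "1 / real n ^ c + real m / real m ^ c \<le> \<rho> / real n"
  proof -
    have "1 / real n ^ c + real m / real m ^ c \<le> (1 + real m) * (1 / real m) ^ c"
      using n_power_ge[of c] by (simp add: power_one_over add_divide_distrib)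
    also have "\<dots> \<le> (1 + real m) * (\<rho> / (real n * (1 + real m)))" using c by (intro mult_left_mono) auto
    also have "\<dots> = \<rho> / real n"
    proof -
      have "1 + real m \<noteq> 0" by linarith
      thus ?thesis by simp
    qed
    finally show ?thesis .
  qed
  define l where "l = L k"
  have kl: "k \<le> l" "1 \<le> l" unfolding l_def using ell_ge[of k] k by auto
  have r0: "0 < r" using r(2) by (rule less_trans[rotated]) simp
  have rn: "r * real n ^ k \<le> 1" using r(1) by (simp add: field_simps)
  have rm: "r * real m ^ l \<le> 1"
  proof -
    have "r * real m ^ l \<le> r * real n ^ k"
      unfolding l_def using r0 power_ell_le[of k] by (intro mult_left_mono) auto
    thus ?thesis using rn by simp
  qed
  have zc: "in_cell \<omega> k l z" by (rule coding_in_cell[OF cod kl(2,1)])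
  have near: "X w k \<in> {X \<omega> k - 1..X \<omega> k + 1} \<and> Y w l \<in> {Y \<omega> l - 1..Y \<omega> l + 1}"
    if w: "w \<in> words l" "p \<in> S w l ` E" "p \<in> ball z r" for w p
  proof -
    have wc: "in_cell w k l p" by (rule S_E_in_cell[OF w(2) words_D[OF w(1)]]) (use kl in auto)
    have "\<bar>fst p - fst z\<bar> < r" "\<bar>snd p - snd z\<bar> < r"
      using coordinates_le_dist[of p z] w(3) by (auto simp: dist_commute)
    hence "\<bar>fst p * real n ^ k - fst z * real n ^ k\<bar> < 1" "\<bar>snd p * real m ^ l - snd z * real m ^ l\<bar> < 1"
      using rn rm by (auto intro!: near_scaled)
    thus ?thesis using wc zc near_interval unfolding in_cell_def by blast
  qed
  have lohi': "lo \<le> log_fib k l w \<and> log_fib k l w \<le> hi"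
    if "w \<in> words l" "p \<in> S w l ` E" "p \<in> ball z r" for w p
    using lohi[of w] near[OF that] that unfolding l_def by blast
  have num: "measure \<mu> (ball z r \<inter> E) \<le> 9 * exp hi / N ^ l"
    unfolding N_def
  proof (rule measure_upper[OF borel_ball_Int_E kl(1)])
    fix w assume w: "w \<in> words l" "S w l ` E \<inter> (ball z r \<inter> E) \<noteq> {}"
    then obtain p where "p \<in> S w l ` E" "p \<in> ball z r" by blast
    from near[OF w(1) this] lohi'[OF w(1) this]
    show "X w k \<in> {X \<omega> k - 1..X \<omega> k + 1} \<and> Y w l \<in> {Y \<omega> l - 1..Y \<omega> l + 1} \<and> log_fib k l w \<le> hi"
      by blast
  qed
  obtain w' where w': "w' \<in> words (l + c)" "z' \<in> S w' (l + c) ` E" using E_word[OF z'(1)] by blast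
  have w'D: "\<And>i. i \<in> {1..l + c} \<Longrightarrow> w' i \<in> D" using words_D[OF w'(1)] .
  define w0 where "w0 = restrict w' {1..l}"
  have w0: "w0 \<in> words l" using w'D by (auto simp: w0_def words_def)
  have "S w0 l = S w' l" by (rule word_map_cong) (simp add: w0_def)
  moreover have "z' \<in> S w' l ` E" using S_E_antimono[of "l + c" w' l, OF w'D] w'(2) by auto
  ultimately have "lo \<le> log_fib k l w0" using lohi'[OF w0 _ z'(2)] by simp
  also have "log_fib k l w0 = log_fib k l w'" by (rule log_fib_cong) (simp add: w0_def)
  finally have lo: "lo \<le> log_fib k l w'" .
  \<comment> \<open>Splitting one sum in two ways shifts both ends by \<open>c\<close>; the only
    loss is the initial block of \<open>c\<close> digits.\<close>
  have "log_fib k (l + c) w' = log_fib k l w' + log_fib l (l + c) w'"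
    "log_fib k (l + c) w' = log_fib k (k + c) w' + log_fib (k + c) (l + c) w'"
    using kl by (auto intro: log_fib_split)
  moreover have "0 \<le> log_fib l (l + c) w'" by (rule log_fib_bounds[OF w'D])
  moreover have "log_fib k (k + c) w' \<le> real (k + c - k) * ln N"
    unfolding N_def by (rule log_fib_bounds) (use w'D kl in auto)
  ultimately have lo': "lo - real c * ln N \<le> log_fib (k + c) (l + c) w'" using lo by simp
  have den: "exp (log_fib (k + c) (l + c) w') / N ^ (l + c) \<le> measure \<mu> (ball z' (\<rho> * r) \<inter> E)"
    unfolding N_def
  proof (rule measure_lower[OF borel_ball_Int_E w'D])
    fix w assume w: "w \<in> cylinder (k + c) (l + c) w'"
    have "p \<in> ball z' (\<rho> * r)" if "p \<in> S w (l + c) ` E" for p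
    proof -
      have "in_cell w' (k + c) (l + c) p"
        by (rule cylinder_in_cell[OF w w'D that]) (use kl in auto)
      moreover have "in_cell w' (k + c) (l + c) z'"
        by (rule S_E_in_cell[OF w'(2) w'D]) (use kl in auto)
      ultimately have "dist z' p \<le> 1 / real n ^ (k + c) + 1 / real m ^ (l + c)"
        by (intro in_cell_dist)
      also have "1 / real m ^ (l + c) \<le> real m / (real n ^ k * real m ^ c)"
      proof -
        have "real n ^ k * real m ^ c \<le> real m * real m ^ l * real m ^ c"
          using power_ell_gt[of k] by (intro mult_right_mono) (auto simp: l_def)
        thus ?thesis by (simp add: field_simps power_add)
      qed
      also have "1 / real n ^ (k + c) + real m / (real n ^ k * real m ^ c) =
          (1 / real n ^ c + real m / real m ^ c) * (1 / real n ^ k)"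
        by (simp add: field_simps power_add)
      also have "\<dots> \<le> \<rho> / real n * (1 / real n ^ k)" by (intro mult_right_mono c') simp
      also have "\<dots> = \<rho> * (1 / real n ^ Suc k)" by simp
      also have "\<dots> < \<rho> * r" using r(2) \<rho> by (intro mult_strict_left_mono)
      finally show ?thesis by simp
    qed
    thus "S w (l + c) ` E \<subseteq> ball z' (\<rho> * r) \<inter> E" using cylinder_S_E_sub[OF w w'D] by blast
  qed (use kl in auto)
  have num0: "0 < measure \<mu> (ball z r \<inter> E)" by (rule measure_ball_pos[OF z r0])
  have den0: "0 < measure \<mu> (ball z' (\<rho> * r) \<inter> E)"
    by (rule measure_ball_pos[OF z'(1)]) (use \<rho> r0 in simp)
  have "ln (measure \<mu> (ball z r \<inter> E)) \<le> ln (9 * exp hi / N ^ l)"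
    using num num0 N by (intro ln_mono) auto
  also have "\<dots> = ln 9 + hi - real l * ln N" using N by (simp add: ln_div ln_mult ln_realpow)
  finally have 1: "ln (measure \<mu> (ball z r \<inter> E)) \<le> ln 9 + hi - real l * ln N" .
  have "ln (exp (log_fib (k + c) (l + c) w') / N ^ (l + c)) \<le> ln (measure \<mu> (ball z' (\<rho> * r) \<inter> E))"
    using den den0 N by (intro ln_mono) auto
  moreover have "ln (exp (log_fib (k + c) (l + c) w') / N ^ (l + c)) =
      log_fib (k + c) (l + c) w' - (real l + real c) * ln N"
    using N by (simp add: ln_div ln_realpow)
  ultimately have 2: "lo - real c * ln N - (real l + real c) * ln N \<le> ln (measure \<mu> (ball z' (\<rho> * r) \<inter> E))"
    using lo' by linarith
  show ?thesis
    using 1 2 num0 den0 unfolding ratio_def ratio_const_def c_def[symmetric] N_def[symmetric]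
    by (simp add: ln_div algebra_simps)
qed

section \<open>Lower bounds for mass ratios from a neighbouring row\<close>

lemma row_set_digit:
  assumes "j \<in> row_set D" shows "\<exists>d\<in>D. snd d = j"
proof -
  have "card {d \<in> D. snd d = j} \<noteq> 0" using assms unfolding row_set_def fiber_count_eq by simp
  hence "{d \<in> D. snd d = j} \<noteq> {}" by (metis card.empty)
  thus ?thesis by blast
qed

lemma bot_in_row_set: "0 \<in> row_set D"
  using fiber_bot_pos by (simp add: row_set_def)

text \<open>Scale \<open>k\<close> exhibits an imbalance of \<open>b\<close> digits. In the
  constant, 9 comes from \<open>measure_upper\<close>, one \<open>ln (card D)\<close> from the digit
  where the carry stops, and one from the row below the lighter row, which the small ball may also
  meet.\<close>

definition unbalanced :: "real \<Rightarrow> real \<times> real \<Rightarrow> nat \<Rightarrow> nat \<Rightarrow> bool" where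
  "unbalanced \<rho> z k b \<longleftrightarrow> (\<exists>z'\<in>E.
     ball z' (\<rho> * (real n ^ 2 / real n ^ k)) \<inter> E \<subseteq> ball z (real n ^ 2 / real n ^ k) \<inter> E \<and>
     real b * lnK - (ln 9 + 2 * ln (real (card D))) \<le> ln (ratio \<rho> (real n ^ 2 / real n ^ k) z z'))"

text \<open>The small ball sits just above the bottom edge of the lower row \<open>u\<close>, so it misses the
  heavy upper row \<open>v\<close>, whereas the ball around \<open>z\<close> contains a whole cell of \<open>v\<close>.\<close>

lemma unbalanced_adjacent_rows:
  assumes \<rho>: "0 < \<rho>" "\<rho> < 1 / real n ^ 3" and k: "1 \<le> k" and z: "z \<in> E"
    and u: "\<And>i. i \<in> {1..L k} \<Longrightarrow> u i \<in> D" and v: "\<And>i. i \<in> {1..L k} \<Longrightarrow> v i \<in> D"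
    and row: "Y v (L k) = Y u (L k) + 1"
    and t: "k \<le> t" "\<And>i. i \<in> {t<..L k} \<Longrightarrow> snd (v i) = 0"
    and xu: "real (X u (k - 1)) \<le> fst z * real n ^ (k - 1)"
      "fst z * real n ^ (k - 1) \<le> real (X u (k - 1)) + 1"
    and xv: "real (X v (k - 1)) \<le> fst z * real n ^ (k - 1)"
      "fst z * real n ^ (k - 1) \<le> real (X v (k - 1)) + 1"
    and yz: "real (Y u (L k)) \<le> snd z * real m ^ L k" "snd z * real m ^ L k \<le> real (Y u (L k)) + 2"
  shows "unbalanced \<rho> z k (L k - t)"
proof -
  define l where "l = L k"
  define N where "N = real (card D)"
  define r where "r = real n ^ 2 / real n ^ k"
  have N: "1 \<le> N" "0 \<le> ln N" unfolding N_def using card_D_ge lnN_nonneg by auto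
  have kl: "k \<le> l" "1 \<le> l" unfolding l_def using ell_ge[of k] k by auto
  have n3: "3 \<le> real n" using n_ge by simp
  have m2: "2 \<le> real m" using m_ge by simp
  have mn: "real m \<le> real n - 1" using m_less by linarith
  have b: "0 < real n ^ k" "0 < real m ^ l" by simp_all
  have r0: "0 < r" unfolding r_def using n3 by simp
  have \<rho>r: "\<rho> * r < 1 / (real n * real n ^ k)"
  proof -
    have "\<rho> * r < 1 / real n ^ 3 * r" using \<rho>(2) r0 by (intro mult_strict_right_mono)
    also have "\<dots> = 1 / (real n * real n ^ k)" unfolding r_def by (simp add: power2_eq_square power3_eq_cube)
    finally show ?thesis .
  qed
  have \<rho>r1: "\<rho> * r < 1 / real n ^ k"
  proof -
    have "1 * real n ^ k \<le> real n * real n ^ k" using n3 by (intro mult_right_mono) auto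
    hence "1 / (real n * real n ^ k) \<le> 1 / real n ^ k" using b n3 by (intro divide_left_mono) auto
    thus ?thesis using \<rho>r by linarith
  qed
  \<comment> \<open>Columns are compared at level \<open>k - 1\<close> only: the two rows may split
    as early as position \<open>k\<close>, and the column digits there may then differ too.\<close>
  have nk1: "1 / real n ^ (k - 1) = real n / real n ^ k"
    using k n3 by (cases k) auto
  have ml: "2 / real m ^ l \<le> 2 * (real n - 1) / real n ^ k"
  proof -
    have "real n ^ k \<le> (real n - 1) * real m ^ l"
    proof -
      have "real m * real m ^ l \<le> (real n - 1) * real m ^ l" by (intro mult_right_mono mn) simp
      thus ?thesis using power_ell_gt[of k] unfolding l_def by linarith
    qed
    thus ?thesis using b by (simp add: field_simps)
  qed
  \<comment> \<open>In units of \<open>1 / n ^ k\<close> the horizontal distance is at most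
    \<open>n\<close>, the vertical one at most \<open>2 * (n - 1)\<close> and the small radius at
    most 1. The sum \<open>3 * n - 1\<close> fits into \<open>n ^ 2\<close> as
    \<open>n \<ge> 3\<close>.\<close>
  have sq: "3 * real n - 1 \<le> real n ^ 2"
  proof -
    have "3 * real n \<le> real n * real n" using n3 by (intro mult_right_mono) auto
    thus ?thesis unfolding power2_eq_square by linarith
  qed
  have rsplit: "real n / real n ^ k + 2 * (real n - 1) / real n ^ k + 1 / real n ^ k \<le> r"
    using sq b by (simp add: r_def add_divide_distrib[symmetric] divide_right_mono)
  obtain h where h: "h \<in> {1..l}" "snd (v h) = snd (u h) + 1"
    "\<bar>log_fib k l v - log_fib k l u - real (l - max k h) * lnK\<bar> \<le> ln N"
    unfolding l_def N_def
    by (rule log_fib_adjacent[where u = u and v = v and l = "L k" and k = k, OF u v row]) blast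
  \<comment> \<open>The carry stops no later than \<open>t\<close>, so at least \<open>l - t\<close>
    digits contribute a gain.\<close>
  have "h \<le> t"
  proof (rule ccontr)
    assume "\<not> h \<le> t"
    hence "h \<in> {t<..L k}" using h(1) unfolding l_def by auto
    hence "snd (v h) = 0" by (rule t(2))
    thus False using h(2) by simp
  qed
  hence "real (l - t) * lnK \<le> real (l - max k h) * lnK"
    using t(1) lnK_nonneg by (intro mult_right_mono) auto
  hence gain: "real (l - t) * lnK - ln N \<le> log_fib k l v - log_fib k l u"
    using h(3) by linarith
  obtain d0 where d0: "d0 \<in> D" "snd d0 = 0" using row_set_digit[OF bot_in_row_set] by blast
  \<comment> \<open>One more digit, in row 0, puts \<open>z'\<close> into the lowest part
    \<open>1 / m \<le> 1 / 2\<close> of row \<open>u\<close>. The small ball reaches less than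
    \<open>1 / 3\<close> of a row height further, and \<open>1 / 2 + 1 / 3 < 1\<close> keeps it off
    row \<open>v\<close>.\<close>
  define u' where "u' = u(Suc l := d0)"
  have u'D: "u' i \<in> D" if "i \<in> {1..Suc l}" for i using u[of i] d0(1) that by (auto simp: u'_def l_def)
  have Xu': "X u' j = X u j" "Y u' j = Y u j" if "j \<le> l" for j
    using that by (auto intro!: radix_cong simp: u'_def)
  obtain e where e: "e \<in> E" using E_ne by blast
  define z' where "z' = S u' (Suc l) e"
  have z'S: "z' \<in> S u' (Suc l) ` E" unfolding z'_def using e by blast
  have z'E: "z' \<in> E" using S_E_sub[of "Suc l" u', OF u'D] z'S by blast
  have c1: "in_cell u' (k - 1) (Suc l) z'" "in_cell u' k l z'"
    by (rule S_E_in_cell[OF z'S u'D]; use kl in simp)+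
  have z'y: "real (Y u l) \<le> snd z' * real m ^ l" "snd z' * real m ^ l \<le> real (Y u l) + 1 / 2"
  proof -
    have "Y u' (Suc l) = m * Y u l" using Xu'(2)[of l] d0(2) by (simp add: u'_def)
    hence "snd z' * real m ^ Suc l \<le> real m * real (Y u l) + 1" using c1(1) by (simp add: in_cell_def)
    also have "\<dots> \<le> real m * (real (Y u l) + 1 / 2)" using m2 by (simp add: algebra_simps)
    finally have "real m * (snd z' * real m ^ l) \<le> real m * (real (Y u l) + 1 / 2)" by (simp add: mult_ac)
    thus "snd z' * real m ^ l \<le> real (Y u l) + 1 / 2" using m2 by (subst (asm) mult_le_cancel_left_pos) auto
    show "real (Y u l) \<le> snd z' * real m ^ l" using c1(2) Xu'(2)[of l] by (simp add: in_cell_def)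
  qed
  have z'x: "real (X u (k - 1)) \<le> fst z' * real n ^ (k - 1)" "fst z' * real n ^ (k - 1) \<le> real (X u (k - 1)) + 1"
    using c1(1) Xu'(1)[of "k - 1"] kl by (auto simp: in_cell_def)
  have dzz': "dist z z' + \<rho> * r \<le> r"
  proof -
    have "\<bar>fst z - fst z'\<bar> \<le> 1 / real n ^ (k - 1)"
      by (rule interval_scaled[OF _ xu z'x]) simp
    moreover have "\<bar>snd z - snd z'\<bar> \<le> 2 / real m ^ l"
      by (rule interval_scaled[where c = "real (Y u l)"]) (use yz z'y in \<open>auto simp: l_def\<close>)
    ultimately show ?thesis
      using dist_le_coordinates[of z z'] nk1 ml rsplit \<rho>r1 by linarith
  qed
  have sub: "ball z' (\<rho> * r) \<inter> E \<subseteq> ball z r \<inter> E"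
  proof
    fix p assume "p \<in> ball z' (\<rho> * r) \<inter> E"
    thus "p \<in> ball z r \<inter> E" using dzz' dist_triangle[of z p z'] by auto
  qed
  have num: "exp (log_fib k l v) / N ^ l \<le> measure \<mu> (ball z r \<inter> E)"
    unfolding N_def
  proof (rule measure_lower[OF borel_ball_Int_E _ kl(1)])
    show vD: "v i \<in> D" if "i \<in> {1..l}" for i using v that unfolding l_def .
    fix w assume w: "w \<in> cylinder k l v"
    have "p \<in> ball z r" if p: "p \<in> S w l ` E" for p
    proof -
      have c: "in_cell v (k - 1) l p" by (rule cylinder_in_cell[OF w vD p]) (use kl in auto)
      have "\<bar>fst z - fst p\<bar> \<le> 1 / real n ^ (k - 1)"
        by (rule interval_scaled[OF _ xv]) (use c in \<open>auto simp: in_cell_def\<close>)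
      moreover have "\<bar>snd z - snd p\<bar> \<le> 2 / real m ^ l"
        by (rule interval_scaled[where c = "real (Y u l)"])
          (use yz c row in \<open>auto simp: l_def in_cell_def\<close>)
      moreover have "0 < 1 / real n ^ k" using b by simp
      ultimately have "dist z p < r"
        using dist_le_coordinates[of z p] nk1 ml rsplit by linarith
      thus ?thesis by simp
    qed
    thus "S w l ` E \<subseteq> ball z r \<inter> E" using cylinder_S_E_sub[OF w vD] by blast
  qed
  have den: "measure \<mu> (ball z' (\<rho> * r) \<inter> E) \<le> 9 * exp (log_fib k l u + ln N) / N ^ l"
    unfolding N_def[symmetric]
  proof (subst N_def, rule measure_upper[OF borel_ball_Int_E kl(1)])
    fix w assume w: "w \<in> words l" "S w l ` E \<inter> (ball z' (\<rho> * r) \<inter> E) \<noteq> {}"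
    then obtain p where p: "p \<in> S w l ` E" "p \<in> ball z' (\<rho> * r)" by blast
    have wD: "\<And>i. i \<in> {1..l} \<Longrightarrow> w i \<in> D" using words_D[OF w(1)] .
    have uD: "\<And>i. i \<in> {1..l} \<Longrightarrow> u i \<in> D" using u unfolding l_def .
    have wc: "in_cell w k l p" by (rule S_E_in_cell[OF p(1) wD]) (use kl in auto)
    have d: "\<bar>fst p - fst z'\<bar> < \<rho> * r" "\<bar>snd p - snd z'\<bar> < \<rho> * r"
      using coordinates_le_dist[of p z'] p(2) by (auto simp: dist_commute)
    have "\<bar>fst p * real n ^ k - fst z' * real n ^ k\<bar> < 1"
    proof (rule near_scaled[OF d(1) b(1)])
      show "\<rho> * r * real n ^ k \<le> 1" using \<rho>r1 b(1) by (simp add: field_simps)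
    qed
    hence X1: "X w k \<in> {X u k - 1..X u k + 1}"
      using wc c1(2) Xu'(1)[of k] kl near_interval[of "X w k" "fst p * real n ^ k" "X u k" "fst z' * real n ^ k"]
      by (simp add: in_cell_def)
    have "\<bar>snd p * real m ^ l - snd z' * real m ^ l\<bar> < 1 / 3"
    proof (rule near_scaled[OF d(2) b(2)])
      have "\<rho> * r * real m ^ l \<le> \<rho> * r * real n ^ k"
        using power_ell_le[of k] \<rho>(1) r0 by (intro mult_left_mono) (auto simp: l_def)
      also have "\<dots> \<le> 1 / (real n * real n ^ k) * real n ^ k"
        using \<rho>r b by (intro mult_right_mono) auto
      also have "\<dots> = 1 / real n" using b by simp
      also have "\<dots> \<le> 1 / 3" using n3 by (intro divide_left_mono) auto
      finally show "\<rho> * r * real m ^ l \<le> 1 / 3" .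
    qed
    hence "real (Y w l) < real (Y u l) + 1" "real (Y u l) < real (Y w l) + 2"
      using z'y wc unfolding in_cell_def by linarith+
    hence Y1: "Y w l = Y u l \<or> Y u l = Y w l + 1" by linarith
    have "log_fib k l w \<le> log_fib k l u + ln N"
      using Y1
    proof
      assume "Y w l = Y u l"
      hence "log_fib k l w = log_fib k l u" using same_row[of l w u, OF wD uD] by (intro log_fib_cong) auto
      thus ?thesis using N by simp
    next
      \<comment> \<open>The small ball may dip into the row below \<open>u\<close>, but that row is
        at most a constant factor heavier than \<open>u\<close>.\<close>
      assume below: "Y u l = Y w l + 1"
      obtain h where "\<bar>log_fib k l u - log_fib k l w - real (l - max k h) * lnK\<bar> \<le> ln N"
        unfolding N_def by (rule log_fib_adjacent[where u = w and v = u and k = k, OF wD uD below]) blast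
      moreover have "0 \<le> real (l - max k h) * lnK" using lnK_nonneg by simp
      ultimately show ?thesis by linarith
    qed
    moreover have "Y w l \<in> {Y u l - 1..Y u l + 1}" using Y1 by auto
    ultimately show "X w k \<in> {X u k - 1..X u k + 1} \<and> Y w l \<in> {Y u l - 1..Y u l + 1} \<and>
        log_fib k l w \<le> log_fib k l u + ln N" using X1 by blast
  qed
  have num0: "0 < measure \<mu> (ball z r \<inter> E)" by (rule measure_ball_pos[OF z r0])
  have den0: "0 < measure \<mu> (ball z' (\<rho> * r) \<inter> E)"
    by (rule measure_ball_pos[OF z'E]) (use \<rho> r0 in simp)
  have "ln (exp (log_fib k l v) / N ^ l) \<le> ln (measure \<mu> (ball z r \<inter> E))"
    using num N by (intro ln_mono) auto
  moreover have "ln (exp (log_fib k l v) / N ^ l) = log_fib k l v - real l * ln N"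
    using N by (simp add: ln_div ln_realpow)
  moreover have "ln (measure \<mu> (ball z' (\<rho> * r) \<inter> E)) \<le> ln (9 * exp (log_fib k l u + ln N) / N ^ l)"
    using den den0 N by (intro ln_mono) auto
  moreover have "ln (9 * exp (log_fib k l u + ln N) / N ^ l) = ln 9 + (log_fib k l u + ln N) - real l * ln N"
  proof -
    have "ln (9 * exp (log_fib k l u + ln N) / N ^ l) = ln (9 * exp (log_fib k l u + ln N)) - ln (N ^ l)"
      using N by (subst ln_div) auto
    also have "ln (9 * exp (log_fib k l u + ln N)) = ln 9 + (log_fib k l u + ln N)"
      by (subst ln_mult) auto
    finally show ?thesis using N by (simp add: ln_realpow)
  qed
  ultimately have "real (l - t) * lnK - (ln 9 + 2 * ln N) \<le> ln (ratio \<rho> r z z')"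
    unfolding ratio_def using gain num0 den0 by (simp add: ln_div)
  thus ?thesis using z'E sub unfolding unbalanced_def r_def l_def N_def by blast
qed

lemma top_in_row_set: "0 < lnK \<Longrightarrow> m - 1 \<in> row_set D"
  by (cases "a (m - 1) = 0") (auto simp: row_set_def)

text \<open>Subtracting one with borrow gives the light row: lower the digit at \<open>h\<close> and
  replace the zeros after it by \<open>m - 1\<close>, a row occupied because \<open>lnK > 0\<close>.
  As \<open>k \<le> h\<close>, the new word agrees with \<open>\<omega>\<close> up to position
  \<open>k - 1\<close> and stays in the same column, close to \<open>z\<close>.\<close>

lemma unbalanced_bot:
  assumes \<rho>: "0 < \<rho>" "\<rho> < 1 / real n ^ 3" and z: "z \<in> E" "is_coding n m D \<omega> z" and K: "0 < lnK"
    and h: "1 \<le> k" "k \<le> h" "h \<le> L k" "snd (\<omega> h) \<in> (\<lambda>j. j + 1) ` row_set D"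
    and zero: "\<And>i. i \<in> {h<..L k} \<Longrightarrow> snd (\<omega> i) = 0"
  shows "unbalanced \<rho> z k (L k - h)"
proof -
  obtain j where j: "j \<in> row_set D" "snd (\<omega> h) = j + 1" using h(4) by blast
  obtain d where d: "d \<in> D" "snd d = j" using row_set_digit[OF j(1)] by blast
  obtain d' where d': "d' \<in> D" "snd d' = m - 1" using row_set_digit[OF top_in_row_set[OF K]] by blast
  define u where "u i = (if i < h then \<omega> i else if i = h then d else d')" for i
  have \<omega>D: "\<omega> i \<in> D" if "i \<in> {1..L k}" for i using z(2) that by (auto simp: is_coding_def digit_seqs_def)
  have uD: "u i \<in> D" if "i \<in> {1..L k}" for i using \<omega>D[OF that] d d' by (simp add: u_def)
  have row: "Y \<omega> (L k) = Y u (L k) + 1"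
    by (rule radix_adjacentI[of h]) (use h j d d' zero in \<open>auto simp: u_def\<close>)
  have X: "X u (k - 1) = X \<omega> (k - 1)" by (rule radix_cong) (use h in \<open>auto simp: u_def\<close>)
  have c: "in_cell \<omega> (k - 1) (L k) z" by (rule coding_in_cell[OF z(2)]) (use h in auto)
  show ?thesis
    by (rule unbalanced_adjacent_rows[OF \<rho> h(1) z(1) uD \<omega>D row h(2) zero])
      (use c X row in \<open>auto simp: in_cell_def\<close>)
qed

text \<open>Adding one with carry: here \<open>\<omega>\<close> itself is the light row, and the new
  final digits lie in row 0, which is occupied because \<open>a 0 > a (m - 1)\<close>.\<close>

lemma unbalanced_top:
  assumes \<rho>: "0 < \<rho>" "\<rho> < 1 / real n ^ 3" and z: "z \<in> E" "is_coding n m D \<omega> z"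
    and h: "1 \<le> k" "k \<le> h" "h \<le> L k" "snd (\<omega> h) + 1 \<in> row_set D"
    and last: "\<And>i. i \<in> {h<..L k} \<Longrightarrow> snd (\<omega> i) = m - 1"
  shows "unbalanced \<rho> z k (L k - h)"
proof -
  obtain d where d: "d \<in> D" "snd d = snd (\<omega> h) + 1" using row_set_digit[OF h(4)] by blast
  obtain d' where d': "d' \<in> D" "snd d' = 0" using row_set_digit[OF bot_in_row_set] by blast
  define v where "v i = (if i < h then \<omega> i else if i = h then d else d')" for i
  have \<omega>D: "\<omega> i \<in> D" if "i \<in> {1..L k}" for i using z(2) that by (auto simp: is_coding_def digit_seqs_def)
  have vD: "v i \<in> D" if "i \<in> {1..L k}" for i using \<omega>D[OF that] d d' by (simp add: v_def)
  have zero: "snd (v i) = 0" if "i \<in> {h<..L k}" for i using that d' by (simp add: v_def)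
  have row: "Y v (L k) = Y \<omega> (L k) + 1"
    by (rule radix_adjacentI[of h]) (use h d d' last in \<open>auto simp: v_def\<close>)
  have X: "X v (k - 1) = X \<omega> (k - 1)" by (rule radix_cong) (use h in \<open>auto simp: v_def\<close>)
  have c: "in_cell \<omega> (k - 1) (L k) z" by (rule coding_in_cell[OF z(2)]) (use h in auto)
  show ?thesis
    by (rule unbalanced_adjacent_rows[OF \<rho> h(1) z(1) \<omega>D vD row h(2) zero])
      (use c X in \<open>auto simp: in_cell_def\<close>)
qed

lemma last_non_props:
  assumes "1 \<le> last_non n m p k w"
  shows "last_non n m p k w \<le> L k" "snd (w (last_non n m p k w)) \<noteq> p"
    "\<And>i. i \<in> {last_non n m p k w<..L k} \<Longrightarrow> snd (w i) = p"
proof -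
  define H where "H = {h. 1 \<le> h \<and> h \<le> L k \<and> snd (w h) \<noteq> p}"
  have fin: "finite H" unfolding H_def by (rule finite_subset[of _ "{..L k}"]) auto
  have eq: "last_non n m p k w = (if H = {} then 0 else Max H)"
    unfolding last_non_def H_def[symmetric] Let_def ..
  have ne: "H \<noteq> {}" using assms eq by auto
  have mem: "last_non n m p k w \<in> H" using eq ne fin by simp
  thus "last_non n m p k w \<le> L k" "snd (w (last_non n m p k w)) \<noteq> p" by (auto simp: H_def)
  fix i assume i: "i \<in> {last_non n m p k w<..L k}"
  show "snd (w i) = p"
  proof (rule ccontr)
    assume "snd (w i) \<noteq> p"
    hence "i \<in> H" using i by (auto simp: H_def)
    hence "i \<le> last_non n m p k w" using eq ne fin by simp
    thus False using i by simp
  qed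
qed

lemma last_non_ge:
  assumes "1 \<le> i" "i \<le> L k" "snd (w i) \<noteq> p" shows "i \<le> last_non n m p k w"
proof -
  define H where "H = {h. 1 \<le> h \<and> h \<le> L k \<and> snd (w h) \<noteq> p}"
  have fin: "finite H" unfolding H_def by (rule finite_subset[of _ "{..L k}"]) auto
  have "i \<in> H" using assms by (simp add: H_def)
  moreover have "last_non n m p k w = (if H = {} then 0 else Max H)"
    unfolding last_non_def H_def[symmetric] Let_def ..
  ultimately show ?thesis using fin by auto
qed

text \<open>If the run of digits \<open>p\<close> starts before level \<open>k\<close>, the neighbouring row need not come close to
  \<open>z\<close> at scale \<open>k\<close>, but it does at the scale where the run starts.\<close>

lemma unbalanced_beta:
  assumes \<rho>: "0 < \<rho>" "\<rho> < 1 / real n ^ 3" and z: "z \<in> E" "is_coding n m D \<omega> z" and K: "0 < lnK"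
    and k: "1 \<le> k" and pos: "0 < beta n m D k \<omega>"
  shows "unbalanced \<rho> z k (beta n m D k \<omega>) \<or>
    (\<exists>p\<in>{0, m - 1}. unbalanced \<rho> z (last_non n m p k \<omega>) (L (last_non n m p k \<omega>) - last_non n m p k \<omega>))"
proof (cases "beta n m D k \<omega> = beta_bot n m D k \<omega>")
  case True
  define h where "h = last_non n m 0 k \<omega>"
  have h: "1 \<le> h \<and> snd (\<omega> h) \<in> (\<lambda>j. j + 1) ` row_set D" and beta: "beta n m D k \<omega> = L k - max k h"
    using True pos unfolding beta_bot_def h_def[symmetric] Let_def by (auto split: if_splits)
  note props = last_non_props[of 0 k \<omega>, folded h_def]
  show ?thesis
  proof (cases "k \<le> h")
    case True
    thus ?thesis using unbalanced_bot[OF \<rho> z K k True] h props beta by (simp add: max_def)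
  next
    case False
    \<comment> \<open>Thus all positions after \<open>h\<close> up to \<open>L h\<close> belong to
      the run, which therefore has full length at scale \<open>h\<close>.\<close>
    hence "L h \<le> L k" by (intro ell_mono) simp
    hence "unbalanced \<rho> z h (L h - h)"
      using unbalanced_bot[OF \<rho> z K, of h h] h props ell_ge[of h] by simp
    thus ?thesis unfolding h_def by blast
  qed
next
  case False
  define h where "h = last_non n m (m - 1) k \<omega>"
  have "beta n m D k \<omega> = beta_top n m D k \<omega>" using False by (auto simp: beta_def max_def split: if_splits)
  hence h: "1 \<le> h \<and> snd (\<omega> h) + 1 \<in> row_set D" and beta: "beta n m D k \<omega> = L k - max k h"
    using pos unfolding beta_top_def h_def[symmetric] Let_def by (auto split: if_splits)
  note props = last_non_props[of "m - 1" k \<omega>, folded h_def]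
  show ?thesis
  proof (cases "k \<le> h")
    case True
    thus ?thesis using unbalanced_top[OF \<rho> z k True] h props beta by (simp add: max_def)
  next
    case False
    hence "L h \<le> L k" by (intro ell_mono) simp
    hence "unbalanced \<rho> z h (L h - h)"
      using unbalanced_top[OF \<rho> z, of h h] h props ell_ge[of h] by simp
    thus ?thesis unfolding h_def by blast
  qed
qed

section \<open>Points with two codings\<close>

text \<open>Both closed cells contain \<open>z\<close> at every level, so the row numbers cannot
  drift apart by more than one. Once they differ by one, this forces digits \<open>m - 1\<close> in
  \<open>\<omega>1\<close> and 0 in \<open>\<omega>2\<close> forever; from \<open>j\<close> on, all
  positions between \<open>k\<close> and \<open>L k\<close> belong to the run.\<close>

lemma adjacent_codings:
  assumes \<rho>: "0 < \<rho>" "\<rho> < 1 / real n ^ 3" and z: "z \<in> E" "is_coding n m D \<omega>1 z" "is_coding n m D \<omega>2 z"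
    and j: "1 \<le> j" "Y \<omega>2 j = Y \<omega>1 j + 1" and k: "j \<le> k"
  shows "unbalanced \<rho> z k (L k - k)"
proof -
  have D1: "\<omega>1 i \<in> D" if "1 \<le> i" for i using z(2) that by (auto simp: is_coding_def digit_seqs_def)
  have D2: "\<omega>2 i \<in> D" if "1 \<le> i" for i using z(3) that by (auto simp: is_coding_def digit_seqs_def)
  have near: "Y \<omega>2 l \<le> Y \<omega>1 l + 1" if "1 \<le> l" for l
  proof -
    have "in_cell \<omega>1 l l z" "in_cell \<omega>2 l l z" using coding_in_cell z that by auto
    hence "real (Y \<omega>2 l) \<le> real (Y \<omega>1 l) + 1" by (auto simp: in_cell_def)
    thus ?thesis by linarith
  qed
  have succ: "Y \<omega>2 (Suc l) = Y \<omega>1 (Suc l) + 1 \<and> snd (\<omega>2 (Suc l)) = 0" if "Y \<omega>2 l = Y \<omega>1 l + 1" for l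
  proof -
    have "snd (\<omega>1 (Suc l)) < m" using digit_less(2)[OF D1] by simp
    moreover have "m * Y \<omega>2 l = m * Y \<omega>1 l + m" using that by simp
    ultimately show ?thesis using near[of "Suc l"] by auto
  qed
  have row: "Y \<omega>2 l = Y \<omega>1 l + 1" if "j \<le> l" for l
    using that
  proof (induction l rule: dec_induct)
    case (step l)
    show ?case using succ[OF step.IH] by blast
  qed (rule j(2))
  have zero: "snd (\<omega>2 i) = 0" if "j < i" for i
    using succ[OF row[of "i - 1"]] that by simp
  have kL: "k \<le> L k" by (rule ell_ge)
  have c: "in_cell \<omega>1 (k - 1) (L k) z" "in_cell \<omega>2 (k - 1) (L k) z"
    using coding_in_cell z(2,3) j k kL by auto
  show ?thesis
    by (rule unbalanced_adjacent_rows[OF \<rho> _ z(1), where u = \<omega>1 and v = \<omega>2])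
      (use D1 D2 row[of "L k"] zero c j k kL in \<open>auto simp: in_cell_def\<close>)
qed

lemma unbalanced_V:
  assumes \<rho>: "0 < \<rho>" "\<rho> < 1 / real n ^ 3" and z: "z \<in> V_set n m D E"
  shows "\<exists>j. \<forall>k\<ge>j. unbalanced \<rho> z k (L k - k)"
proof -
  obtain \<omega>1 \<omega>2 j where c: "is_coding n m D \<omega>1 z" "is_coding n m D \<omega>2 z" and j: "1 \<le> j" "snd (\<omega>1 j) \<noteq> snd (\<omega>2 j)"
    and zE: "z \<in> E"
    using z unfolding V_set_def by blast
  have D: "\<omega>1 i \<in> D" "\<omega>2 i \<in> D" if "i \<in> {1..j}" for i
    using c that by (auto simp: is_coding_def digit_seqs_def)
  have "Y \<omega>1 j \<noteq> Y \<omega>2 j"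
    using same_row[of j \<omega>1 \<omega>2 j] D j by auto
  moreover have "in_cell \<omega>1 j j z" "in_cell \<omega>2 j j z" using coding_in_cell c j by auto
  hence "real (Y \<omega>2 j) \<le> real (Y \<omega>1 j) + 1" "real (Y \<omega>1 j) \<le> real (Y \<omega>2 j) + 1" by (auto simp: in_cell_def)
  ultimately have "Y \<omega>2 j = Y \<omega>1 j + 1 \<or> Y \<omega>1 j = Y \<omega>2 j + 1" by linarith
  thus ?thesis
    using adjacent_codings[OF \<rho> zE c(1,2) j(1)] adjacent_codings[OF \<rho> zE c(2,1) j(1)] by blast
qed

text \<open>Every point of \<open>E\<close> has a preimage in \<open>E\<close> under one of the
  maps; dependent choice of preimages continues the finite word to a coding.\<close>

lemma E_coding_extend:
  assumes w: "\<And>i. i \<in> {1..l} \<Longrightarrow> w i \<in> D" and z: "z \<in> S w l ` E"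
  obtains \<omega> where "is_coding n m D \<omega> z" "\<And>i. i \<in> {1..l} \<Longrightarrow> \<omega> i = w i"
proof -
  obtain e where e: "e \<in> E" "z = S w l e" using z by blast
  \<comment> \<open>The clause for \<open>j = 0\<close> pins the start of the chain of preimages at
    \<open>e\<close>.\<close>
  have "\<exists>f. \<forall>j. (f j \<in> E \<and> (j = 0 \<longrightarrow> f j = e)) \<and> (\<exists>d\<in>D. f j = bm_map n m d (f (Suc j)))"
  proof (rule dependent_nat_choice)
    show "\<exists>x. x \<in> E \<and> ((0::nat) = 0 \<longrightarrow> x = e)" using e by blast
    fix x and j :: nat assume "x \<in> E \<and> (j = 0 \<longrightarrow> x = e)"
    then obtain d y where "d \<in> D" "y \<in> E" "x = bm_map n m d y" using E_eq by blast
    thus "\<exists>y. (y \<in> E \<and> (Suc j = 0 \<longrightarrow> y = e)) \<and> (\<exists>d\<in>D. x = bm_map n m d y)"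
      by (intro exI[of _ y]) blast
  qed
  then obtain f where f: "\<And>j. f j \<in> E" "f 0 = e" "\<And>j. \<exists>d\<in>D. f j = bm_map n m d (f (Suc j))" by blast
  obtain g where g: "\<And>j. g j \<in> D" "\<And>j. f j = bm_map n m (g j) (f (Suc j))" using f(3) by metis
  define \<omega> where "\<omega> i = (if i \<le> l then w i else g (i - Suc l))" for i
  have \<omega>D: "\<omega> i \<in> D" if "1 \<le> i" for i using w[of i] g(1) that by (simp add: \<omega>_def)
  have "S \<omega> l = S w l" by (rule word_map_cong) (simp add: \<omega>_def)
  hence tail: "z = S \<omega> (l + j) (f j)" for j
  proof (induction j)
    case (Suc j)
    have "\<omega> (Suc (l + j)) = g j" by (simp add: \<omega>_def)
    thus ?case using Suc g(2)[of j] by simp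
  qed (use e f(2) in simp)
  have mem: "z \<in> S \<omega> j ` unit_sq" for j
  proof -
    have "z \<in> S \<omega> (l + j) ` unit_sq" using tail[of j] f(1)[of j] E_sub by blast
    thus ?thesis using S_unit_antimono[of "l + j" \<omega> j] \<omega>D by auto
  qed
  have "p = z" if p: "\<And>j. 1 \<le> j \<Longrightarrow> p \<in> S \<omega> j ` unit_sq" for p
  proof (rule ccontr)
    assume "p \<noteq> z"
    then obtain j where j: "(1 / real m) ^ j < dist p z / 2" using inverse_power_small[of "dist p z / 2"] by auto
    have "(1 / real m) ^ Suc j \<le> (1 / real m) ^ j" using m_ge by (intro power_decreasing) auto
    hence "(1 / real m) ^ Suc j < dist p z / 2" using j by linarith
    moreover have "dist p z \<le> 1 / real n ^ Suc j + 1 / real m ^ Suc j"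
      using p[of "Suc j"] mem[of "Suc j"] by (intro in_cell_dist) (auto simp: S_in_cell_iff simp del: word_map.simps)
    ultimately show False using n_power_ge[of "Suc j"] by (simp add: power_one_over del: power_Suc)
  qed
  hence "{z} = (\<Inter>k\<in>{1..}. S \<omega> k ` unit_sq)" using mem by auto
  hence "is_coding n m D \<omega> z" using \<omega>D by (auto simp: is_coding_def digit_seqs_def)
  moreover have "\<omega> i = w i" if "i \<in> {1..l}" for i using that by (simp add: \<omega>_def)
  ultimately show ?thesis using that by blast
qed

text \<open>The finitely many pieces of level \<open>h\<close> that miss \<open>z\<close> form a
  closed set, avoided by a small ball. A piece meeting that ball thus contains \<open>z\<close> and
  extends to a coding of \<open>z\<close>; outside \<open>V_set\<close> all codings have the same
  rows.\<close>

lemma not_V_separation: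
  assumes "z \<in> E" "z \<notin> V_set n m D E" "is_coding n m D \<omega> z"
  obtains e where "0 < e"
    "\<And>w l i. \<lbrakk>h \<le> l; w \<in> words l; S w l ` E \<inter> ball z e \<noteq> {}; i \<in> {1..h}\<rbrakk> \<Longrightarrow> snd (w i) = snd (\<omega> i)"
proof -
  define F where "F = (\<Union>v\<in>{v \<in> words h. z \<notin> S v h ` E}. S v h ` E)"
  have "closed (S v h ` E)" for v
    using compact_E continuous_on_subset[OF continuous_on_word_map[OF pos]]
    by (intro compact_imp_closed compact_continuous_image) auto
  hence "closed F" unfolding F_def using finite_words by (intro closed_UN) auto
  moreover have "z \<in> - F" unfolding F_def by blast
  ultimately obtain e where e: "0 < e" "ball z e \<subseteq> - F"
    using open_contains_ball[of "- F"] by (auto simp: open_Compl)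
  show ?thesis
  proof (rule that[OF e(1)])
    fix w l i assume w: "h \<le> l" "w \<in> words l" "S w l ` E \<inter> ball z e \<noteq> {}" and i: "i \<in> {1..h}"
    have wD: "\<And>i. i \<in> {1..l} \<Longrightarrow> w i \<in> D" using words_D[OF w(2)] .
    define v where "v = restrict w {1..h}"
    have v: "v \<in> words h" using wD w(1) by (auto simp: v_def words_def)
    have "S v h = S w h" by (rule word_map_cong) (simp add: v_def)
    moreover obtain p where p: "p \<in> S w l ` E" "p \<in> ball z e" using w(3) by blast
    ultimately have "p \<in> S v h ` E" using S_E_antimono[of l w h, OF wD w(1)] by auto
    hence "z \<in> S v h ` E" using p(2) e(2) v unfolding F_def by blast
    then obtain \<omega>' where \<omega>': "is_coding n m D \<omega>' z" "\<And>i. i \<in> {1..h} \<Longrightarrow> \<omega>' i = v i"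
      using E_coding_extend[of h v z] words_D[OF v] by blast
    have "\<forall>j\<ge>1. snd (\<omega>' j) = snd (\<omega> j)" using assms \<omega>'(1) unfolding V_set_def by blast
    hence "snd (\<omega>' i) = snd (\<omega> i)" using i by simp
    moreover have "\<omega>' i = w i" using \<omega>'(2)[OF i] i by (simp add: v_def)
    ultimately show "snd (w i) = snd (\<omega> i)" by simp
  qed
qed

end

section \<open>Limits along geometric scales\<close>

lemma ex_scale:
  fixes n :: nat and r :: real
  assumes "2 \<le> n" "0 < r" "r \<le> 1 / real n ^ K"
  obtains k where "K \<le> k" "1 / real n ^ Suc k < r" "r \<le> 1 / real n ^ k"
proof -
  define P where "P j \<longleftrightarrow> 1 / real n ^ Suc j < r" for j
  have n1: "1 < real n" using assms(1) by simp
  obtain j where j: "(1 / real n) ^ j < r" using real_arch_pow_inv[OF assms(2), of "1 / real n"] n1 by auto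
  have "(1 / real n) ^ Suc j \<le> (1 / real n) ^ j" using n1 by (intro power_decreasing) auto
  hence "P j" using j unfolding P_def by (simp add: power_one_over del: power_Suc)
  define k where "k = (LEAST j. P j)"
  have Pk: "P k" unfolding k_def by (rule LeastI) (rule \<open>P j\<close>)
  have min: "\<not> P i" if "i < k" for i using not_less_Least that unfolding k_def by blast
  have "K \<le> k"
  proof (rule ccontr)
    assume "\<not> K \<le> k"
    hence "real n ^ Suc k \<le> real n ^ K" using n1 by (intro power_increasing) auto
    hence "1 / real n ^ K \<le> 1 / real n ^ Suc k" using n1 by (intro divide_left_mono) auto
    thus False using Pk assms(3) unfolding P_def by linarith
  qed
  moreover have "r \<le> 1 / real n ^ k"
  proof (cases "k = K")
    case False
    hence "\<not> P (k - 1)" "Suc (k - 1) = k" using \<open>K \<le> k\<close> min[of "k - 1"] by auto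
    thus ?thesis unfolding P_def by simp
  qed (use assms in simp)
  ultimately show ?thesis using that Pk unfolding P_def by blast
qed

lemma Limsup_scales_le:
  fixes f :: "real \<Rightarrow> ereal" and n :: nat
  assumes "2 \<le> n"
    and "\<forall>\<^sub>F k in sequentially. \<forall>r. 1 / real n ^ Suc k < r \<longrightarrow> r \<le> 1 / real n ^ k \<longrightarrow> f r \<le> g k"
  shows "Limsup (at_right 0) f \<le> limsup g"
  unfolding Limsup_le_iff
proof (intro allI impI)
  fix y assume "limsup g < y"
  hence "\<forall>\<^sub>F k in sequentially. g k < y" by (rule Limsup_lessD)
  with assms(2) have "\<forall>\<^sub>F k in sequentially. \<forall>r. 1 / real n ^ Suc k < r \<longrightarrow> r \<le> 1 / real n ^ k \<longrightarrow> f r < y"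
    by eventually_elim (blast intro: le_less_trans)
  then obtain K where K: "\<And>k r. K \<le> k \<Longrightarrow> 1 / real n ^ Suc k < r \<Longrightarrow> r \<le> 1 / real n ^ k \<Longrightarrow> f r < y"
    unfolding eventually_sequentially by blast
  have "f r < y" if r: "0 < r" "r < 1 / real n ^ K" for r
  proof -
    obtain k where "K \<le> k" "1 / real n ^ Suc k < r" "r \<le> 1 / real n ^ k"
      using ex_scale[OF assms(1) r(1) less_imp_le[OF r(2)]] by blast
    thus ?thesis by (intro K)
  qed
  moreover have "0 < 1 / real n ^ K" using assms(1) by simp
  ultimately show "\<forall>\<^sub>F r in at_right 0. f r < y"
    unfolding eventually_at_right_field by blast
qed

text \<open>For a lower bound one sequence of radii tending to 0 suffices, with the estimate at
  infinitely many of its members.\<close>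

lemma Limsup_scales_ge:
  fixes f :: "real \<Rightarrow> ereal" and n :: nat
  assumes "2 \<le> n" and "\<exists>\<^sub>F k in sequentially. y \<le> f (real n ^ 2 / real n ^ k)"
  shows "y \<le> Limsup (at_right 0) f"
proof (rule ccontr)
  assume "\<not> y \<le> Limsup (at_right 0) f"
  hence "\<forall>\<^sub>F r in at_right 0. f r < y" by (intro Limsup_lessD) simp
  moreover have "filterlim (\<lambda>k. real n ^ 2 / real n ^ k) (at_right 0) sequentially"
  proof -
    have "(\<lambda>k. real n ^ 2 * (1 / real n) ^ k) \<longlonglongrightarrow> real n ^ 2 * 0"
      using assms(1) by (intro tendsto_mult tendsto_const LIMSEQ_power_zero) auto
    hence "(\<lambda>k. real n ^ 2 / real n ^ k) \<longlonglongrightarrow> 0" by (simp add: power_one_over)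
    thus ?thesis using assms(1) by (auto simp: filterlim_at intro!: eventuallyI)
  qed
  ultimately have "\<forall>\<^sub>F k in sequentially. f (real n ^ 2 / real n ^ k) < y" by (rule eventually_compose_filterlim)
  hence "\<forall>\<^sub>F k in sequentially. \<not> y \<le> f (real n ^ 2 / real n ^ k)" by (rule eventually_mono) simp
  thus False using assms(2) by (simp add: frequently_def)
qed

text \<open>Reduces the bound to real \<open>b\<close>, so that an infinite \<open>x\<close>,
  possible when \<open>s\<close> is infinite, needs no separate argument.\<close>

lemma ereal_mult_le_if_below:
  fixes x y :: ereal
  assumes "0 < c" "\<And>b. ereal b < x \<Longrightarrow> ereal (b * c) \<le> y"
  shows "x * ereal c \<le> y"
proof (rule ccontr)
  assume "\<not> x * ereal c \<le> y"
  hence "y < x * ereal c" by simp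
  then obtain b where b: "y < ereal b" "ereal b < x * ereal c" using ereal_dense2 by blast
  have "ereal (b / c) < x" using b(2) assms(1) by (cases x) (auto simp: field_simps)
  from assms(2)[OF this] have "ereal b \<le> y" using assms(1) by simp
  thus False using b(1) by simp
qed

section \<open>The upper doubling index\<close>

locale bm_gauge = bm_carpet +
  fixes \<phi> :: "real \<Rightarrow> real" and s :: ereal and \<rho> :: real and z :: "real \<times> real"
    and \<omega> :: "nat \<Rightarrow> nat \<times> nat"
  assumes gauge: "gauge_function \<phi>"
    and gauge_lim: "(\<lambda>k. ereal (real k / \<phi> (1 / real n ^ k))) \<longlonglongrightarrow> s"
    and \<rho>: "0 < \<rho>" "\<rho> < 1 / real n ^ 3"
    and z: "z \<in> E" and coding: "is_coding n m D \<omega> z"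
begin

abbreviation "\<phi>n k \<equiv> \<phi> (1 / real n ^ k)"
abbreviation "index \<equiv> upper_doubling_index E \<phi> \<mu> \<rho> z"

lemma two_le_n: "2 \<le> n" using n_ge by simp

lemma inverse_n_power: "1 \<le> k \<Longrightarrow> 1 / real n ^ k \<in> {0<..<1}"
  using n_ge by (auto simp: one_less_power)

lemma \<phi>_pos: "x \<in> {0<..<1} \<Longrightarrow> 0 < \<phi> x"
  using gauge unfolding gauge_function_def by blast

lemma \<phi>n_pos: "1 \<le> k \<Longrightarrow> 0 < \<phi>n k"
  by (intro \<phi>_pos inverse_n_power)

lemma \<phi>_antimono: "x \<in> {0<..<1} \<Longrightarrow> y \<in> {0<..<1} \<Longrightarrow> x \<le> y \<Longrightarrow> \<phi> y \<le> \<phi> x"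
  using gauge unfolding gauge_function_def by (cases "x = y") (force intro: less_imp_le)+

lemma \<rho>_less_1: "\<rho> < 1"
proof -
  have "1 / real n ^ 3 \<in> {0<..<1}" by (rule inverse_n_power) simp
  thus ?thesis using \<rho> unfolding greaterThanLessThan_iff by linarith
qed

lemma const_over_\<phi>n: "(\<lambda>k. C / \<phi>n k) \<longlonglongrightarrow> 0"
proof -
  have "(\<lambda>k. 1 / real n ^ k) \<longlonglongrightarrow> 0"
    using LIMSEQ_power_zero[of "1 / real n"] n_ge by (simp add: power_one_over)
  hence "filterlim (\<lambda>k. 1 / real n ^ k) (at_right 0) sequentially"
    using n_ge by (auto simp: filterlim_at intro!: eventuallyI)
  moreover have "filterlim \<phi> at_top (at_right 0)" using gauge unfolding gauge_function_def by blast
  ultimately have "filterlim \<phi>n at_top sequentially" by (rule filterlim_compose[rotated])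
  thus ?thesis by (intro tendsto_divide_0[OF tendsto_const] filterlim_at_top_imp_at_infinity)
qed

text \<open>By the floor in \<open>ell\<close>, \<open>L k - k\<close> is within 1 of
  \<open>k * (1 / bm_sigma n m - 1)\<close>, and an error of 1 vanishes against the gauge. This is
  the limit for runs of maximal length.\<close>

lemma run_limit:
  "(\<lambda>k. ereal (real (L k - k) / \<phi>n k)) \<longlonglongrightarrow> s * ereal (1 / bm_sigma n m - 1)"
proof -
  define c where "c = 1 / bm_sigma n m - 1"
  have c0: "0 < c" unfolding c_def using sigma_inverse_gt by simp
  have up: "(\<lambda>k. ereal (real k * c / \<phi>n k)) \<longlonglongrightarrow> s * ereal c"
  proof -
    have "(\<lambda>k. ereal (real k / \<phi>n k) * ereal c) \<longlonglongrightarrow> s * ereal c"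
      using c0 by (intro tendsto_mult_ereal gauge_lim tendsto_const) auto
    thus ?thesis by (simp add: field_simps)
  qed
  have "(\<lambda>k. ereal (real k * c / \<phi>n k) + ereal (- 1 / \<phi>n k)) \<longlonglongrightarrow> s * ereal c + ereal 0"
    by (intro tendsto_add_ereal_general up tendsto_ereal const_over_\<phi>n) auto
  hence low: "(\<lambda>k. ereal ((real k * c - 1) / \<phi>n k)) \<longlonglongrightarrow> s * ereal c"
    by (simp add: diff_divide_distrib zero_ereal_def[symmetric])
  have bounds: "real k * c - 1 \<le> real (L k - k)" "real (L k - k) \<le> real k * c" for k
  proof -
    have "real (L k - k) = real (L k) - real k" using ell_ge[of k] by simp
    moreover have "real k * c = real k / bm_sigma n m - real k" unfolding c_def by (simp add: algebra_simps)
    ultimately show "real k * c - 1 \<le> real (L k - k)" "real (L k - k) \<le> real k * c"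
      using ell_le[of k] ell_gt[of k] by linarith+
  qed
  show ?thesis
    unfolding c_def[symmetric]
  proof (rule tendsto_sandwich[OF _ _ low up])
    show "\<forall>\<^sub>F k in sequentially. ereal ((real k * c - 1) / \<phi>n k) \<le> ereal (real (L k - k) / \<phi>n k)"
      using eventually_ge_at_top[of 1]
    proof eventually_elim
      case (elim k)
      thus ?case using bounds(1)[of k] \<phi>n_pos[of k] by (auto intro: divide_right_mono)
    qed
    show "\<forall>\<^sub>F k in sequentially. ereal (real (L k - k) / \<phi>n k) \<le> ereal (real k * c / \<phi>n k)"
      using eventually_ge_at_top[of 1]
    proof eventually_elim
      case (elim k)
      thus ?case using bounds(2)[of k] \<phi>n_pos[of k] by (auto intro: divide_right_mono)
    qed
  qed
qed

section \<open>From estimates at each scale to the index\<close>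

definition ratio_sup :: "real \<Rightarrow> ereal" where
  "ratio_sup r = (SUP z'\<in>{z'\<in>E. ball z' (\<rho> * r) \<inter> E \<subseteq> ball z r \<inter> E}. ereal (ln (ratio \<rho> r z z') / \<phi> r))"

lemma index_eq: "index = Limsup (at_right 0) ratio_sup"
  unfolding upper_doubling_index_def ratio_sup_def[abs_def] ratio_def ..

lemma ratio_sup_nonneg:
  assumes "r \<in> {0<..<1}" shows "0 \<le> ratio_sup r"
proof -
  have sub: "ball z (\<rho> * r) \<inter> E \<subseteq> ball z r \<inter> E"
    using assms \<rho>_less_1 \<rho> by (intro Int_mono subset_ball) (auto simp: mult_le_cancel_right1)
  have "0 < measure \<mu> (ball z (\<rho> * r) \<inter> E)" using assms \<rho> by (intro measure_ball_pos[OF z]) auto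
  moreover have "measure \<mu> (ball z (\<rho> * r) \<inter> E) \<le> measure \<mu> (ball z r \<inter> E)"
    using sub borel_ball_Int_E by (intro finite_measure_mono) auto
  ultimately have "1 \<le> ratio \<rho> r z z" unfolding ratio_def by simp
  hence "0 \<le> ln (ratio \<rho> r z z) / \<phi> r" using \<phi>_pos[OF assms] by (intro divide_nonneg_pos) auto
  hence "0 \<le> ereal (ln (ratio \<rho> r z z) / \<phi> r)" by simp
  also have "\<dots> \<le> ratio_sup r" unfolding ratio_sup_def by (rule SUP_upper) (use z sub in simp)
  finally show ?thesis .
qed

lemma index_nonneg: "0 \<le> index"
proof -
  have "\<forall>\<^sub>F r in at_right 0. 0 \<le> ratio_sup r"
    unfolding eventually_at_right_field by (rule exI[of _ 1]) (auto intro: ratio_sup_nonneg)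
  hence "0 \<le> Liminf (at_right 0) ratio_sup" by (rule Liminf_bounded)
  also have "\<dots> \<le> Limsup (at_right 0) ratio_sup" by (rule Liminf_le_Limsup) simp
  finally show ?thesis unfolding index_eq .
qed

text \<open>Since \<open>r \<le> 1 / n ^ k\<close>, the gauge at \<open>r\<close> is at least
  \<open>\<phi>n k\<close>; as the numerator bound is nonnegative, passing to
  \<open>\<phi>n k\<close> only enlarges the quotient.\<close>

lemma index_le:
  assumes "0 \<le> C" and "\<And>k. 0 \<le> B k"
    and bound: "\<And>k r z'. \<lbrakk>k0 \<le> k; 1 / real n ^ Suc k < r; r \<le> 1 / real n ^ k; z' \<in> E; z' \<in> ball z r\<rbrakk>
      \<Longrightarrow> ln (ratio \<rho> r z z') \<le> B k + C"
  shows "index \<le> limsup (\<lambda>k. ereal (B k / \<phi>n k))"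
proof -
  have "index \<le> limsup (\<lambda>k. ereal ((B k + C) / \<phi>n k))"
    unfolding index_eq
  proof (rule Limsup_scales_le[OF two_le_n])
    show "\<forall>\<^sub>F k in sequentially. \<forall>r. 1 / real n ^ Suc k < r \<longrightarrow> r \<le> 1 / real n ^ k \<longrightarrow>
        ratio_sup r \<le> ereal ((B k + C) / \<phi>n k)"
      using eventually_ge_at_top[of "max 1 k0"]
    proof (eventually_elim, intro allI impI)
      fix k r assume k: "max 1 k0 \<le> k" and r: "1 / real n ^ Suc k < r" "r \<le> 1 / real n ^ k"
      have k1: "1 / real n ^ k \<in> {0<..<1}" using k by (intro inverse_n_power) simp
      have "0 < 1 / real n ^ Suc k" using n_ge by simp
      hence r01: "r \<in> {0<..<1}" using r k1 unfolding greaterThanLessThan_iff by linarith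
      show "ratio_sup r \<le> ereal ((B k + C) / \<phi>n k)"
        unfolding ratio_sup_def
      proof (rule SUP_least)
        fix z' assume z': "z' \<in> {z' \<in> E. ball z' (\<rho> * r) \<inter> E \<subseteq> ball z r \<inter> E}"
        moreover have "z' \<in> ball z' (\<rho> * r)" using \<rho> r01 by simp
        ultimately have "z' \<in> E" "z' \<in> ball z r" by blast+
        hence "ln (ratio \<rho> r z z') \<le> B k + C" using bound k r by simp
        hence "ln (ratio \<rho> r z z') / \<phi> r \<le> (B k + C) / \<phi> r"
          using \<phi>_pos[OF r01] by (simp add: divide_right_mono)
        also have "\<dots> \<le> (B k + C) / \<phi>n k"
          using \<phi>_antimono[OF r01 k1 r(2)] assms(1) assms(2)[of k] \<phi>_pos[OF k1] \<phi>_pos[OF r01]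
          by (intro divide_left_mono) auto
        finally show "ereal (ln (ratio \<rho> r z z') / \<phi> r) \<le> ereal ((B k + C) / \<phi>n k)" by simp
      qed
    qed
  qed
  also have "(\<lambda>k. ereal ((B k + C) / \<phi>n k)) = (\<lambda>k. ereal (C / \<phi>n k) + ereal (B k / \<phi>n k))"
    by (simp add: add_divide_distrib add.commute)
  also have "limsup \<dots> = ereal 0 + limsup (\<lambda>k. ereal (B k / \<phi>n k))"
    by (rule ereal_limsup_lim_add) (use const_over_\<phi>n in auto)
  finally show ?thesis by (simp add: zero_ereal_def[symmetric])
qed

text \<open>At the radius \<open>n ^ 2 / n ^ k\<close> the gauge is at most
  \<open>\<phi>n k\<close>, so the exchange now lowers the quotient. The constant in
  \<open>unbalanced\<close> costs an arbitrarily small \<open>e\<close>.\<close>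

lemma index_ge:
  assumes "0 < lnK" and "\<exists>\<^sub>F k in sequentially. unbalanced \<rho> z k (b k) \<and> c < real (b k) / \<phi>n k"
  shows "ereal (c * lnK) \<le> index"
proof (rule ereal_le_epsilon2)
  fix e :: real assume e: "0 < e"
  define C where "C = ln 9 + 2 * ln (real (card D))"
  have "\<forall>\<^sub>F k in sequentially. C / \<phi>n k < e"
    using const_over_\<phi>n[of C] e by (intro order_tendstoD)
  hence ev: "\<forall>\<^sub>F k in sequentially. C / \<phi>n k < e \<and> 3 \<le> k"
    using eventually_ge_at_top[of 3] by eventually_elim simp
  have "ereal (c * lnK - e) \<le> index"
    unfolding index_eq
  proof (rule Limsup_scales_ge[OF two_le_n], rule frequently_elim1[OF frequently_eventually_conj[OF assms(2) ev]])
    fix k assume "(C / \<phi>n k < e \<and> 3 \<le> k) \<and> unbalanced \<rho> z k (b k) \<and> c < real (b k) / \<phi>n k"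
    hence k: "C / \<phi>n k < e" "3 \<le> k" "c < real (b k) / \<phi>n k" and un: "unbalanced \<rho> z k (b k)" by auto
    define r where "r = real n ^ 2 / real n ^ k"
    have k1: "1 / real n ^ k \<in> {0<..<1}" using k(2) by (intro inverse_n_power) simp
    have p0: "0 < \<phi>n k" by (rule \<phi>_pos[OF k1])
    have "real n ^ 2 < real n ^ k" using k(2) n_ge by (intro power_strict_increasing) auto
    hence r01: "r \<in> {0<..<1}" using n_ge by (simp add: r_def)
    have kr: "1 / real n ^ k \<le> r" using n_ge unfolding r_def by (intro divide_right_mono) auto
    obtain z' where z': "z' \<in> E" "ball z' (\<rho> * r) \<inter> E \<subseteq> ball z r \<inter> E"
      "real (b k) * lnK - C \<le> ln (ratio \<rho> r z z')"
      using un unfolding unbalanced_def r_def C_def by blast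
    have main: "c * lnK - e \<le> (real (b k) * lnK - C) / \<phi>n k"
    proof -
      have "c * lnK \<le> real (b k) / \<phi>n k * lnK" using k(3) assms(1) by (intro mult_right_mono) auto
      thus ?thesis using k(1) by (simp add: diff_divide_distrib)
    qed
    \<comment> \<open>Monotonicity of the gauge helps only for a nonnegative numerator. Otherwise
      the claimed bound is at most 0 and \<open>ratio_sup_nonneg\<close> suffices, which rests on
      the choice \<open>z' = z\<close>.\<close>
    show "ereal (c * lnK - e) \<le> ratio_sup (real n ^ 2 / real n ^ k)"
    proof (cases "0 \<le> real (b k) * lnK - C")
      case True
      have "(real (b k) * lnK - C) / \<phi>n k \<le> (real (b k) * lnK - C) / \<phi> r"
        using True \<phi>_antimono[OF k1 r01 kr] \<phi>_pos[OF r01] p0 by (intro divide_left_mono) auto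
      also have "\<dots> \<le> ln (ratio \<rho> r z z') / \<phi> r"
        using z'(3) \<phi>_pos[OF r01] by (intro divide_right_mono) auto
      finally have "ereal (c * lnK - e) \<le> ereal (ln (ratio \<rho> r z z') / \<phi> r)" using main by simp
      also have "\<dots> \<le> ratio_sup r" unfolding ratio_sup_def by (rule SUP_upper) (use z' in simp)
      finally show ?thesis unfolding r_def .
    next
      case False
      hence "(real (b k) * lnK - C) / \<phi>n k \<le> 0" using p0 by (intro divide_nonpos_pos) auto
      hence "ereal (c * lnK - e) \<le> 0" using main by simp
      thus ?thesis using ratio_sup_nonneg[OF r01] unfolding r_def by (rule order_trans)
    qed
  qed
  thus "ereal (c * lnK) \<le> index + ereal e" by (cases index) auto
qed

text \<open>Up to constants the row above can only be heavier and the row below only lighter. So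
  \<open>beta_top\<close> enters only upper bounds and \<open>beta_bot\<close> only lower bounds;
  the first and third estimates serve when the critical row is excluded.\<close>

lemma log_fib_neighbours:
  assumes k: "1 \<le> k" and w: "w \<in> words (L k)" and row: "Y w (L k) \<in> {Y \<omega> (L k) - 1..Y \<omega> (L k) + 1}"
  defines "N \<equiv> ln (real (card D))"
  shows "Y w (L k) \<noteq> Y \<omega> (L k) + 1 \<Longrightarrow> log_fib k (L k) w \<le> log_fib k (L k) \<omega> + N"
    "log_fib k (L k) w \<le> log_fib k (L k) \<omega> + real (beta_top n m D k \<omega>) * lnK + N"
    "Y \<omega> (L k) \<noteq> Y w (L k) + 1 \<Longrightarrow> log_fib k (L k) \<omega> - N \<le> log_fib k (L k) w"
    "log_fib k (L k) \<omega> - real (beta_bot n m D k \<omega>) * lnK - N \<le> log_fib k (L k) w"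
proof -
  have wD: "\<And>i. i \<in> {1..L k} \<Longrightarrow> w i \<in> D" using words_D[OF w] .
  have \<omega>D: "\<And>i. i \<in> {1..L k} \<Longrightarrow> \<omega> i \<in> D" using coding by (auto simp: is_coding_def digit_seqs_def)
  have nn: "0 \<le> real (beta_top n m D k \<omega>) * lnK" "0 \<le> real (beta_bot n m D k \<omega>) * lnK" "0 \<le> N"
    using lnK_nonneg lnN_nonneg unfolding N_def by auto
  have eq: "log_fib k (L k) w = log_fib k (L k) \<omega>" if "Y w (L k) = Y \<omega> (L k)"
    using same_row[of "L k" w \<omega>, OF wD \<omega>D that] by (intro log_fib_cong) auto
  note above = row_above[of k w \<omega>, OF wD \<omega>D, folded N_def]
  note below = row_below[of k w \<omega>, OF wD \<omega>D, folded N_def]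
  consider "Y w (L k) = Y \<omega> (L k)" | "Y w (L k) = Y \<omega> (L k) + 1" | "Y \<omega> (L k) = Y w (L k) + 1"
    using row by force
  note cases = this
  show "Y w (L k) \<noteq> Y \<omega> (L k) + 1 \<Longrightarrow> log_fib k (L k) w \<le> log_fib k (L k) \<omega> + N"
    by (rule cases) (use eq above below nn in linarith)+
  show "log_fib k (L k) w \<le> log_fib k (L k) \<omega> + real (beta_top n m D k \<omega>) * lnK + N"
    by (rule cases) (use eq above below nn in linarith)+
  show "Y \<omega> (L k) \<noteq> Y w (L k) + 1 \<Longrightarrow> log_fib k (L k) \<omega> - N \<le> log_fib k (L k) w"
    by (rule cases) (use eq above below nn in linarith)+
  show "log_fib k (L k) \<omega> - real (beta_bot n m D k \<omega>) * lnK - N \<le> log_fib k (L k) w"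
    by (rule cases) (use eq above below nn in linarith)+
qed

lemma index_upper: "index \<le> limsup (\<lambda>k. ereal (real (beta n m D k \<omega>) / \<phi>n k)) * ereal lnK"
proof -
  define N where "N = ln (real (card D))"
  have "index \<le> limsup (\<lambda>k. ereal (real (beta n m D k \<omega>) * lnK / \<phi>n k))"
  proof (rule index_le[where C = "2 * N + ratio_const \<rho>" and ?k0.0 = 1])
    show "0 \<le> 2 * N + ratio_const \<rho>" using ratio_const_nonneg[of \<rho>] lnN_nonneg unfolding N_def by simp
    show "0 \<le> real (beta n m D k \<omega>) * lnK" for k using lnK_nonneg by simp
    fix k r z' assume k: "1 \<le> k" and r: "1 / real n ^ Suc k < r" "r \<le> 1 / real n ^ k" and z': "z' \<in> E" "z' \<in> ball z r"
    define lo where "lo = log_fib k (L k) \<omega> - real (beta_bot n m D k \<omega>) * lnK - N"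
    define hi where "hi = log_fib k (L k) \<omega> + real (beta_top n m D k \<omega>) * lnK + N"
    have "ln (ratio \<rho> r z z') \<le> hi - lo + ratio_const \<rho>"
    proof (rule ratio_upper[OF \<rho>(1) coding z k r(2,1) z'])
      fix w assume "w \<in> words (L k)" "Y w (L k) \<in> {Y \<omega> (L k) - 1..Y \<omega> (L k) + 1}"
      thus "lo \<le> log_fib k (L k) w \<and> log_fib k (L k) w \<le> hi"
        unfolding lo_def hi_def N_def using log_fib_neighbours(2,4)[OF k] by blast
    qed
    also have "hi - lo + ratio_const \<rho> = real (beta n m D k \<omega>) * lnK + (2 * N + ratio_const \<rho>)"
      unfolding lo_def hi_def beta_eq_sum[OF k] by (simp add: algebra_simps)
    finally show "ln (ratio \<rho> r z z') \<le> real (beta n m D k \<omega>) * lnK + (2 * N + ratio_const \<rho>)" .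
  qed
  also have "(\<lambda>k. ereal (real (beta n m D k \<omega>) * lnK / \<phi>n k)) =
      (\<lambda>k. ereal (real (beta n m D k \<omega>) / \<phi>n k) * ereal lnK)" by simp
  also have "limsup \<dots> = limsup (\<lambda>k. ereal (real (beta n m D k \<omega>) / \<phi>n k)) * ereal lnK"
    using lnK_nonneg by (intro Limsup_ereal_mult_right) auto
  finally show ?thesis .
qed

lemma limsup_beta_le:
  "limsup (\<lambda>k. ereal (real (beta n m D k \<omega>) / \<phi>n k)) \<le> s * ereal (1 / bm_sigma n m - 1)"
proof -
  have "\<forall>\<^sub>F k in sequentially. ereal (real (beta n m D k \<omega>) / \<phi>n k) \<le> ereal (real (L k - k) / \<phi>n k)"
    using eventually_ge_at_top[of 1]
  proof eventually_elim
    case (elim k)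
    thus ?case using beta_le[of k \<omega>] \<phi>n_pos[of k] by (auto intro: divide_right_mono)
  qed
  hence "limsup (\<lambda>k. ereal (real (beta n m D k \<omega>) / \<phi>n k)) \<le> limsup (\<lambda>k. ereal (real (L k - k) / \<phi>n k))"
    by (rule Limsup_mono)
  also have "\<dots> = s * ereal (1 / bm_sigma n m - 1)" using run_limit by (intro lim_imp_Limsup) auto
  finally show ?thesis .
qed

lemma index_lower_generic:
  assumes "\<omega> \<notin> Omega_set D 0 \<union> Omega_set D (m - 1)"
  shows "limsup (\<lambda>k. ereal (real (beta n m D k \<omega>) / \<phi>n k)) * ereal lnK \<le> index"
proof (cases "lnK = 0")
  case True
  thus ?thesis using index_nonneg by (simp add: zero_ereal_def[symmetric])
next
  case False
  hence K: "0 < lnK" using lnK_nonneg by simp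
  show ?thesis
  proof (rule ereal_mult_le_if_below[OF K])
    fix c assume "ereal c < limsup (\<lambda>k. ereal (real (beta n m D k \<omega>) / \<phi>n k))"
    then obtain c' where c': "ereal c < ereal c'" "ereal c' < limsup (\<lambda>k. ereal (real (beta n m D k \<omega>) / \<phi>n k))"
      using ereal_dense2 by blast
    show "ereal (c * lnK) \<le> index"
    proof (cases "0 \<le> c")
      case c0: True
      have "\<exists>\<^sub>F k in sequentially. c' < real (beta n m D k \<omega>) / \<phi>n k"
      proof (rule ccontr)
        assume "\<not> ?thesis"
        hence "\<forall>\<^sub>F k in sequentially. ereal (real (beta n m D k \<omega>) / \<phi>n k) \<le> ereal c'"
          by (simp add: frequently_def not_less)
        hence "limsup (\<lambda>k. ereal (real (beta n m D k \<omega>) / \<phi>n k)) \<le> ereal c'" by (rule Limsup_bounded)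
        thus False using c'(2) by simp
      qed
      hence "\<exists>\<^sub>F k in sequentially. 1 \<le> k \<and> c' < real (beta n m D k \<omega>) / \<phi>n k"
        using eventually_ge_at_top[of 1] by (rule frequently_eventually_conj)
      \<comment> \<open>For infinitely many \<open>k\<close>, either scale \<open>k\<close> itself
        is unbalanced or the scale must be moved to the start of the run; one of the two cases
        occurs infinitely often.\<close>
      hence split: "\<exists>\<^sub>F k in sequentially. unbalanced \<rho> z k (beta n m D k \<omega>) \<and> c < real (beta n m D k \<omega>) / \<phi>n k \<or>
         (\<exists>p\<in>{0, m - 1}. unbalanced \<rho> z (last_non n m p k \<omega>) (L (last_non n m p k \<omega>) - last_non n m p k \<omega>))"
      proof (rule frequently_elim1)
        fix k assume k: "1 \<le> k \<and> c' < real (beta n m D k \<omega>) / \<phi>n k"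
        hence "0 < real (beta n m D k \<omega>) / \<phi>n k" using c0 c'(1) by auto
        hence "0 < beta n m D k \<omega>" by (cases "beta n m D k \<omega> = 0") auto
        thus "unbalanced \<rho> z k (beta n m D k \<omega>) \<and> c < real (beta n m D k \<omega>) / \<phi>n k \<or>
         (\<exists>p\<in>{0, m - 1}. unbalanced \<rho> z (last_non n m p k \<omega>) (L (last_non n m p k \<omega>) - last_non n m p k \<omega>))"
          using unbalanced_beta[OF \<rho> z coding K, of k] k c'(1) by auto
      qed
      hence "(\<exists>\<^sub>F k in sequentially. unbalanced \<rho> z k (beta n m D k \<omega>) \<and> c < real (beta n m D k \<omega>) / \<phi>n k) \<or>
         (\<exists>\<^sub>F k in sequentially. \<exists>p\<in>{0, m - 1}. unbalanced \<rho> z (last_non n m p k \<omega>) (L (last_non n m p k \<omega>) - last_non n m p k \<omega>))"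
        by (simp add: frequently_disj_iff)
      thus ?thesis
      proof
        assume "\<exists>\<^sub>F k in sequentially. unbalanced \<rho> z k (beta n m D k \<omega>) \<and> c < real (beta n m D k \<omega>) / \<phi>n k"
        thus ?thesis by (rule index_ge[OF K])
      next
        assume fr: "\<exists>\<^sub>F k in sequentially. \<exists>p\<in>{0, m - 1}.
          unbalanced \<rho> z (last_non n m p k \<omega>) (L (last_non n m p k \<omega>) - last_non n m p k \<omega>)"
        \<comment> \<open>The moved scales must still be unbounded. Digits other than 0, and digits
          other than \<open>m - 1\<close>, occur beyond every \<open>H\<close>, which pushes both
          values of \<open>last_non\<close> beyond \<open>H\<close> for large
          \<open>k\<close>.\<close>
        have "\<exists>h\<ge>H. unbalanced \<rho> z h (L h - h)" for H
        proof -
          have ex: "\<exists>i\<ge>Suc H. snd (\<omega> i) \<noteq> p" if "p \<in> {0, m - 1}" for p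
          proof (rule ccontr)
            assume "\<not> ?thesis"
            hence "\<forall>\<^sub>F i in sequentially. snd (\<omega> i) = p" unfolding eventually_sequentially by blast
            moreover have "\<omega> \<in> digit_seqs D" using coding by (simp add: is_coding_def)
            ultimately show False using assms that by (auto simp: Omega_set_def)
          qed
          obtain i0 where i0: "Suc H \<le> i0" "snd (\<omega> i0) \<noteq> 0" using ex[of 0] by auto
          obtain i1 where i1: "Suc H \<le> i1" "snd (\<omega> i1) \<noteq> m - 1" using ex[of "m - 1"] by auto
          obtain k p where k: "max i0 i1 \<le> k" "p \<in> {0, m - 1}"
            "unbalanced \<rho> z (last_non n m p k \<omega>) (L (last_non n m p k \<omega>) - last_non n m p k \<omega>)"
            using fr unfolding frequently_sequentially by meson
          have "i0 \<le> L k" "i1 \<le> L k" using k(1) ell_ge[of k] by auto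
          hence "i0 \<le> last_non n m 0 k \<omega>" "i1 \<le> last_non n m (m - 1) k \<omega>"
            using i0 i1 by (auto intro!: last_non_ge)
          hence "H \<le> last_non n m p k \<omega>" using k(2) i0 i1 by auto
          thus ?thesis using k(3) by blast
        qed
        hence fr': "\<exists>\<^sub>F h in sequentially. unbalanced \<rho> z h (L h - h)" unfolding frequently_sequentially by blast
        \<comment> \<open>At the moved scales the normalised run length converges to an upper bound
          of the limsup of \<open>beta\<close>, so it eventually exceeds \<open>c\<close>, whatever
          the original \<open>k\<close> was.\<close>
        have "ereal c < s * ereal (1 / bm_sigma n m - 1)" using c' limsup_beta_le by (meson less_le_trans less_trans)
        hence "\<forall>\<^sub>F h in sequentially. ereal c < ereal (real (L h - h) / \<phi>n h)"
          using run_limit by (rule order_tendstoD(1)[rotated])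
        hence "\<exists>\<^sub>F h in sequentially. ereal c < ereal (real (L h - h) / \<phi>n h) \<and> unbalanced \<rho> z h (L h - h)"
          using fr' by (intro frequently_eventually_conj)
        hence "\<exists>\<^sub>F h in sequentially. unbalanced \<rho> z h (L h - h) \<and> c < real (L h - h) / \<phi>n h"
          by (rule frequently_elim1) auto
        thus ?thesis by (rule index_ge[OF K])
      qed
    next
      case False
      hence "c * lnK \<le> 0" using K by (simp add: mult_le_0_iff)
      hence "ereal (c * lnK) \<le> 0" by simp
      thus ?thesis using index_nonneg by (rule order_trans)
    qed
  qed
qed

lemma index_lower_V:
  assumes "z \<in> V_set n m D E"
  shows "s * ereal (1 / bm_sigma n m - 1) * ereal lnK \<le> index"
proof (cases "lnK = 0")
  case True
  thus ?thesis using index_nonneg by (simp add: zero_ereal_def[symmetric])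
next
  case False
  hence K: "0 < lnK" using lnK_nonneg by simp
  obtain j where j: "\<And>k. j \<le> k \<Longrightarrow> unbalanced \<rho> z k (L k - k)" using unbalanced_V[OF \<rho> assms] by blast
  show ?thesis
  proof (rule ereal_mult_le_if_below[OF K])
    fix c assume "ereal c < s * ereal (1 / bm_sigma n m - 1)"
    hence "\<forall>\<^sub>F k in sequentially. ereal c < ereal (real (L k - k) / \<phi>n k)"
      using run_limit by (rule order_tendstoD(1)[rotated])
    hence "\<forall>\<^sub>F k in sequentially. unbalanced \<rho> z k (L k - k) \<and> c < real (L k - k) / \<phi>n k"
      using eventually_ge_at_top[of j] by eventually_elim (use j in auto)
    hence "\<exists>\<^sub>F k in sequentially. unbalanced \<rho> z k (L k - k) \<and> c < real (L k - k) / \<phi>n k"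
      by (intro eventually_frequently) auto
    thus "ereal (c * lnK) \<le> index" by (rule index_ge[OF K])
  qed
qed

text \<open>If \<open>\<omega>\<close> ends in zeros, a row below would require a borrow at a
  position up to \<open>h\<close>, yet near \<open>z\<close> the first \<open>h\<close> row digits
  are fixed. A row above is heavier by a bounded factor only, since the digit 0 at
  \<open>L k\<close> leaves no run of \<open>m - 1\<close>. Final digits \<open>m - 1\<close> are
  treated symmetrically.\<close>

lemma index_not_V:
  assumes V: "z \<notin> V_set n m D E" and \<Omega>: "\<omega> \<in> Omega_set D 0 \<union> Omega_set D (m - 1)"
  shows "index \<le> 0"
proof -
  define N where "N = ln (real (card D))"
  obtain p where p: "p = 0 \<or> p = m - 1" "\<omega> \<in> Omega_set D p" using \<Omega> by blast
  then obtain h where h: "\<And>i. h \<le> i \<Longrightarrow> snd (\<omega> i) = p"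
    unfolding Omega_set_def eventually_sequentially by blast
  obtain e where e: "0 < e"
    "\<And>w l i. \<lbrakk>h \<le> l; w \<in> words l; S w l ` E \<inter> ball z e \<noteq> {}; i \<in> {1..h}\<rbrakk> \<Longrightarrow> snd (w i) = snd (\<omega> i)"
    using not_V_separation[OF z V coding, of h] by blast
  obtain k1 where k1: "(1 / real m) ^ k1 < e" using inverse_power_small[OF e(1)] by blast
  have "index \<le> limsup (\<lambda>k. ereal (0 / \<phi>n k))"
  proof (rule index_le[where C = "2 * N + ratio_const \<rho>" and ?k0.0 = "max (Suc h) k1"])
    show "0 \<le> 2 * N + ratio_const \<rho>" using ratio_const_nonneg[of \<rho>] lnN_nonneg unfolding N_def by simp
    fix k r z' assume k: "max (Suc h) k1 \<le> k" and r: "1 / real n ^ Suc k < r" "r \<le> 1 / real n ^ k"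
      and z': "z' \<in> E" "z' \<in> ball z r"
    have kl: "1 \<le> k" "k \<le> L k" "h \<le> L k" using k ell_ge[of k] by auto
    have re: "ball z r \<subseteq> ball z e"
    proof -
      have "1 / real n ^ k \<le> (1 / real m) ^ k" using n_power_ge[of k] by (simp add: power_one_over)
      also have "\<dots> \<le> (1 / real m) ^ k1" using m_ge k by (intro power_decreasing) auto
      finally show ?thesis using r(2) k1 by (intro subset_ball) linarith
    qed
    have \<omega>D: "\<omega> i \<in> D" if "i \<in> {1..L k}" for i using coding that by (auto simp: is_coding_def digit_seqs_def)
    have "ln (ratio \<rho> r z z') \<le> (log_fib k (L k) \<omega> + N) - (log_fib k (L k) \<omega> - N) + ratio_const \<rho>"
    proof (rule ratio_upper[OF \<rho>(1) coding z kl(1) r(2,1) z'])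
      fix w assume w: "w \<in> words (L k)" "S w (L k) ` E \<inter> ball z r \<noteq> {}"
        and row: "Y w (L k) \<in> {Y \<omega> (L k) - 1..Y \<omega> (L k) + 1}"
      have wD: "\<And>i. i \<in> {1..L k} \<Longrightarrow> w i \<in> D" using words_D[OF w(1)] .
      have pre: "snd (w i) = snd (\<omega> i)" if "i \<in> {1..h}" for i
        using e(2)[OF kl(3) w(1) _ that] w(2) re by blast
      have up: "Y w (L k) \<noteq> Y \<omega> (L k) + 1" if pm: "p = m - 1"
      proof
        assume row: "Y w (L k) = Y \<omega> (L k) + 1"
        obtain h' where h': "h' \<in> {1..L k}" "snd (w h') = snd (\<omega> h') + 1"
          by (rule log_fib_adjacent[where u = \<omega> and v = w and k = k, OF \<omega>D wD row]) blast
        have "h' \<le> h"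
        proof (rule ccontr)
          assume "\<not> h' \<le> h"
          hence "snd (\<omega> h') = m - 1" using h[of h'] pm by simp
          thus False using h'(2) digit_less(2)[OF wD[OF h'(1)]] by simp
        qed
        thus False using pre[of h'] h' by simp
      qed
      have down: "Y \<omega> (L k) \<noteq> Y w (L k) + 1" if p0: "p = 0"
      proof
        assume row: "Y \<omega> (L k) = Y w (L k) + 1"
        obtain h' where h': "h' \<in> {1..L k}" "snd (\<omega> h') = snd (w h') + 1"
          by (rule log_fib_adjacent[where u = w and v = \<omega> and k = k, OF wD \<omega>D row]) blast
        have "h' \<le> h"
        proof (rule ccontr)
          assume "\<not> h' \<le> h"
          hence "snd (\<omega> h') = 0" using h[of h'] p0 by simp
          thus False using h'(2) by simp
        qed
        thus False using pre[of h'] h' by simp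
      qed
      have last: "snd (\<omega> (L k)) = p" using h kl by simp
      note nb = log_fib_neighbours[OF kl(1) w(1) row, folded N_def]
      from p(1) show "log_fib k (L k) \<omega> - N \<le> log_fib k (L k) w \<and> log_fib k (L k) w \<le> log_fib k (L k) \<omega> + N"
      proof
        assume "p = 0"
        moreover from this have "beta_top n m D k \<omega> = 0" using beta_top_eq_0[OF kl(1), of \<omega>] last m_ge by simp
        ultimately show ?thesis using nb(2,3) down by simp
      next
        assume "p = m - 1"
        moreover from this have "beta_bot n m D k \<omega> = 0" using beta_bot_eq_0[OF kl(1), of \<omega>] last m_ge by simp
        ultimately show ?thesis using nb(1,4) up by simp
      qed
    qed
    thus "ln (ratio \<rho> r z z') \<le> 0 + (2 * N + ratio_const \<rho>)" by simp
  qed simp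
  thus ?thesis by (simp add: zero_ereal_def[symmetric] Limsup_const)
qed

end

theorem theorem1p2:
  fixes n m :: nat and D :: "(nat \<times> nat) set" and E :: "(real \<times> real) set"
    and \<mu> :: "(real \<times> real) measure" and \<phi> :: "real \<Rightarrow> real" and s :: ereal
    and \<rho> :: real and z :: "real \<times> real" and \<omega> :: "nat \<Rightarrow> nat \<times> nat"
  assumes "2 \<le> m" and "m < n"
    and "D \<subseteq> {0..<n} \<times> {0..<m}" and "D \<noteq> {}"
    and "is_carpet n m D E"
    and "is_uniform_bernoulli n m D E \<mu>"
    and "\<not> doubling \<mu>"
    and "fiber_count D 0 > fiber_count D (m - 1)"
    and "gauge_function \<phi>"
    and "(\<lambda>k. ereal (real k / \<phi> (1 / real n ^ k))) \<longlonglongrightarrow> s" and "0 < s"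
    and "0 < \<rho>" and "\<rho> < 1 / real n ^ 3"
    and "z \<in> E" and "is_coding n m D \<omega> z"
  shows "(\<omega> \<notin> Omega_set D 0 \<union> Omega_set D (m - 1) \<longrightarrow>
            upper_doubling_index E \<phi> \<mu> \<rho> z =
              limsup (\<lambda>k. ereal (real (beta n m D k \<omega>) / \<phi> (1 / real n ^ k))) *
              ereal (ln (real (fiber_count D 0) / real (fiber_count D (m - 1))))) \<and>
         (\<omega> \<in> Omega_set D 0 \<union> Omega_set D (m - 1) \<longrightarrow>
            upper_doubling_index E \<phi> \<mu> \<rho> z =
              s * ereal (1 / bm_sigma n m - 1) *
              ereal (ln (real (fiber_count D 0) / real (fiber_count D (m - 1)))) *
              indicator (V_set n m D E) z)"
proof -
  interpret bm_gauge n m D E \<mu> \<phi> s \<rho> z \<omega>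
    by unfold_locales (fact assms)+
  \<comment> \<open>The general upper bound is capped by the maximal run length, which points of
    \<open>V_set\<close> attain at all large scales.\<close>
  have V: "index = s * ereal (1 / bm_sigma n m - 1) * ereal lnK" if "z \<in> V_set n m D E"
  proof (rule antisym)
    note index_upper
    also have "limsup (\<lambda>k. ereal (real (beta n m D k \<omega>) / \<phi>n k)) * ereal lnK \<le>
        s * ereal (1 / bm_sigma n m - 1) * ereal lnK"
      using limsup_beta_le lnK_nonneg by (intro ereal_mult_right_mono) auto
    finally show "index \<le> s * ereal (1 / bm_sigma n m - 1) * ereal lnK" .
  qed (rule index_lower_V[OF that])
  have notV: "index = 0" if "\<omega> \<in> Omega_set D 0 \<union> Omega_set D (m - 1)" "z \<notin> V_set n m D E"
    using index_not_V[OF that(2,1)] index_nonneg by (rule antisym)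
  show ?thesis
    using antisym[OF index_upper index_lower_generic] V notV by (cases "z \<in> V_set n m D E") auto
qed

end
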